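(* Let $W_\alpha$ be a contractive weighted shift with positive weight sequence $\alpha$. Then $W_\alpha$ is moment infinitely divisible if and only if its moment sequence $\gamma=(\gamma_n)_{n\ge0}$ is log completely monotone, i.e. $\sum_{i=0}^n(-1)^i\binom{n}{i}\ln\gamma_{k+i}\ge 0$ for all $n\ge 1$ and $k\ge 0$.
   Context: For a bounded sequence $\alpha=(\alpha_n)_{n\ge 0}$ of positive numbers, the weighted shift $W_\alpha$ on $\ell^2(\mathbb{N}_0)$ (canonical basis $e_0,e_1,\dots$) is the bounded linear operator with $W_\alpha e_n=\alpha_n e_{n+1}$. It is contractive if $\|W_\alpha\|=\sup_n\alpha_n\le 1$. Its moments are $\gamma_0=1$ and $\gamma_n=\prod_{j=0}^{n-1}\alpha_j^2$ for $n\ge 1$. An operator is subnormal if it is the restriction of a normal operator to a closed invariant subspace. $W_\alpha$ is moment infinitely divisible (written $W_\alpha\in\mathcal{MID}$) if for every $p\ge 0$ the weighted shift $W_\alpha^{(p)}$ with weights $(\alpha_n^p)_{n\ge0}$ is subnormal. *)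

theory Defs
  imports "HOL-Analysis.Analysis" "HOL-Algebra.Module"
begin

section \<open>Complex Hilbert spaces\<close>

text \<open>
  Subnormality asks for the existence of a larger Hilbert space, and HOL cannot quantify over
  types inside a formula. Hilbert spaces are therefore structures on a carrier set: modules (in
  the sense of HOL-Algebra, whose record fields \<open>mult\<close> and \<open>one\<close> carry no
  meaning here) over the field of complex numbers, extended by an inner product that is linear in
  its first argument.
\<close>

definition complex_field :: "complex ring"
  where "complex_field = \<lparr>carrier = UNIV, mult = (*), one = 1, zero = 0, add = (+)\<rparr>"

record 'a inner_space = "(complex, 'a) module" +
  cinner :: "'a \<Rightarrow> 'a \<Rightarrow> complex"

definition hnorm :: "('a, 'm) inner_space_scheme \<Rightarrow> 'a \<Rightarrow> real"
  where "hnorm H x = sqrt (Re (cinner H x x))"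

text \<open>The locale \<open>Metric_space\<close> wants a nonnegative symmetric function on the whole type,
  whence the cut-off outside the carrier.\<close>

definition hdist :: "('a, 'm) inner_space_scheme \<Rightarrow> 'a \<Rightarrow> 'a \<Rightarrow> real"
  where "hdist H x y =
    (if x \<in> carrier H \<and> y \<in> carrier H then hnorm H (x \<ominus>\<^bsub>H\<^esub> y) else 0)"

locale hilbert_space = module complex_field H for H :: "('a, 'm) inner_space_scheme" (structure) +
  assumes cinner_add_left:
      "\<lbrakk>x \<in> carrier H; y \<in> carrier H; z \<in> carrier H\<rbrakk>
        \<Longrightarrow> cinner H (x \<oplus>\<^bsub>H\<^esub> y) z = cinner H x z + cinner H y z"
    and cinner_smult_left:
      "\<lbrakk>x \<in> carrier H; y \<in> carrier H\<rbrakk> \<Longrightarrow> cinner H (c \<odot>\<^bsub>H\<^esub> x) y = c * cinner H x y"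
    and cinner_commute:
      "\<lbrakk>x \<in> carrier H; y \<in> carrier H\<rbrakk> \<Longrightarrow> cinner H x y = cnj (cinner H y x)"
    and cinner_nonneg: "x \<in> carrier H \<Longrightarrow> Re (cinner H x x) \<ge> 0"
    and cinner_definite: "\<lbrakk>x \<in> carrier H; cinner H x x = 0\<rbrakk> \<Longrightarrow> x = \<zero>\<^bsub>H\<^esub>"
    and complete: "Metric_space.mcomplete (carrier H) (hdist H)"

definition closed_subspace :: "'a set \<Rightarrow> ('a, 'm) inner_space_scheme \<Rightarrow> bool"
  where "closed_subspace M H \<longleftrightarrow>
    submodule M complex_field H \<and> closedin (Metric_space.mtopology (carrier H) (hdist H)) M"


section \<open>Bounded operators\<close>

definition complex_linear ::
    "('a, 'm) inner_space_scheme \<Rightarrow> ('b, 'n) inner_space_scheme \<Rightarrow> ('a \<Rightarrow> 'b) \<Rightarrow> bool"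
  where "complex_linear H K T \<longleftrightarrow>
    T \<in> carrier H \<rightarrow> carrier K \<and>
    (\<forall>x\<in>carrier H. \<forall>y\<in>carrier H. T (x \<oplus>\<^bsub>H\<^esub> y) = T x \<oplus>\<^bsub>K\<^esub> T y) \<and>
    (\<forall>c. \<forall>x\<in>carrier H. T (c \<odot>\<^bsub>H\<^esub> x) = c \<odot>\<^bsub>K\<^esub> T x)"

definition bounded_operator :: "('a, 'm) inner_space_scheme \<Rightarrow> ('a \<Rightarrow> 'a) \<Rightarrow> bool"
  where "bounded_operator H T \<longleftrightarrow>
    complex_linear H H T \<and> (\<exists>C. \<forall>x\<in>carrier H. hnorm H (T x) \<le> C * hnorm H x)"

definition operator_norm :: "('a, 'm) inner_space_scheme \<Rightarrow> ('a \<Rightarrow> 'a) \<Rightarrow> real"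
  where "operator_norm H T = (SUP x\<in>{x \<in> carrier H. hnorm H x \<le> 1}. hnorm H (T x))"

definition contractive :: "('a, 'm) inner_space_scheme \<Rightarrow> ('a \<Rightarrow> 'a) \<Rightarrow> bool"
  where "contractive H T \<longleftrightarrow> bounded_operator H T \<and> operator_norm H T \<le> 1"

definition is_adjoint :: "('a, 'm) inner_space_scheme \<Rightarrow> ('a \<Rightarrow> 'a) \<Rightarrow> ('a \<Rightarrow> 'a) \<Rightarrow> bool"
  where "is_adjoint H T S \<longleftrightarrow>
    bounded_operator H S \<and>
    (\<forall>x\<in>carrier H. \<forall>y\<in>carrier H. cinner H (T x) y = cinner H x (S y))"

definition normal_operator :: "('a, 'm) inner_space_scheme \<Rightarrow> ('a \<Rightarrow> 'a) \<Rightarrow> bool"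
  where "normal_operator H N \<longleftrightarrow>
    bounded_operator H N \<and>
    (\<exists>S. is_adjoint H N S \<and> (\<forall>x\<in>carrier H. N (S x) = S (N x)))"

definition unitary_onto ::
    "('a, 'm) inner_space_scheme \<Rightarrow> ('b, 'n) inner_space_scheme \<Rightarrow> 'b set \<Rightarrow> ('a \<Rightarrow> 'b) \<Rightarrow> bool"
  where "unitary_onto H K M V \<longleftrightarrow>
    complex_linear H K V \<and> bij_betw V (carrier H) M \<and>
    (\<forall>x\<in>carrier H. \<forall>y\<in>carrier H. cinner K (V x) (V y) = cinner H x y)"

text \<open>
  \<open>T\<close> is the restriction of a normal operator \<open>N\<close> on \<open>K\<close> to a closed
  invariant subspace \<open>M\<close> of \<open>K\<close>, where \<open>V\<close> identifies the space of
  \<open>T\<close> with \<open>M\<close>. The type \<open>'k\<close> bounds the size of the Hilbert spaces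
  \<open>K\<close> that are taken into account and has to be large enough. For an operator on a
  separable space, any type into which \<open>nat \<Rightarrow> complex\<close> embeds suffices: the smallest
  closed subspace that contains \<open>M\<close> and reduces \<open>N\<close> is separable, hence it can be
  realised on such a type.
\<close>

definition subnormal :: "'k itself \<Rightarrow> ('a, 'm) inner_space_scheme \<Rightarrow> ('a \<Rightarrow> 'a) \<Rightarrow> bool"
  where "subnormal (_ :: 'k itself) H T \<longleftrightarrow>
    (\<exists>(K :: 'k inner_space) N M V.
       hilbert_space K \<and> normal_operator K N \<and>
       closed_subspace M K \<and> N ` M \<subseteq> M \<and>
       unitary_onto H K M V \<and> (\<forall>x\<in>carrier H. V (T x) = N (V x)))"


section \<open>Weighted shifts\<close>

definition ell2 :: "(nat \<Rightarrow> complex) inner_space"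
  where "ell2 = \<lparr>carrier = {x. summable (\<lambda>n. (cmod (x n))\<^sup>2)},
    mult = undefined, one = undefined,
    zero = (\<lambda>n. 0), add = (\<lambda>x y n. x n + y n), smult = (\<lambda>c x n. c * x n),
    cinner = (\<lambda>x y. \<Sum>n. x n * cnj (y n))\<rparr>"

definition basis_vector :: "nat \<Rightarrow> nat \<Rightarrow> complex"
  where "basis_vector n = (\<lambda>k. if k = n then 1 else 0)"

definition weighted_shift :: "(nat \<Rightarrow> real) \<Rightarrow> (nat \<Rightarrow> complex) \<Rightarrow> (nat \<Rightarrow> complex)"
  where "weighted_shift \<alpha> x = (\<lambda>n. case n of 0 \<Rightarrow> 0 | Suc m \<Rightarrow> of_real (\<alpha> m) * x m)"

lemma weighted_shift_basis_vector:
  "weighted_shift \<alpha> (basis_vector n) = of_real (\<alpha> n) \<odot>\<^bsub>ell2\<^esub> basis_vector (Suc n)"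
  by (auto simp: weighted_shift_def basis_vector_def ell2_def fun_eq_iff split: nat.split)

definition moment :: "(nat \<Rightarrow> real) \<Rightarrow> nat \<Rightarrow> real"
  where "moment \<alpha> n = (\<Prod>j<n. (\<alpha> j)\<^sup>2)"

definition moment_infinitely_divisible :: "'k itself \<Rightarrow> (nat \<Rightarrow> real) \<Rightarrow> bool"
  where "moment_infinitely_divisible (u :: 'k itself) \<alpha> \<longleftrightarrow>
    (\<forall>p::real. p \<ge> 0 \<longrightarrow> subnormal u ell2 (weighted_shift (\<lambda>n. \<alpha> n powr p)))"

definition log_completely_monotone :: "(nat \<Rightarrow> real) \<Rightarrow> bool"
  where "log_completely_monotone \<gamma> \<longleftrightarrow>
    (\<forall>n\<ge>1. \<forall>k. (\<Sum>i=0..n. (-1) ^ i * real (n choose i) * ln (\<gamma> (k + i))) \<ge> 0)"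

end

theory Submission
  imports Defs
begin

text \<open>
  Write $\gamma$ for the moment sequence and call a sequence completely monotone if all its
  differences $\sum_i (-1)^i \binom{n}{i} a_{k+i}$ are nonnegative. The moments of the shift with
  weights $\alpha_n^p$ are $\gamma_n^p$. By Berger's theorem a contractive weighted shift is
  subnormal if and only if its moments are completely monotone, so the theorem amounts to: all
  powers $\gamma^p$ with $p > 0$ are completely monotone if and only if the differences of
  positive order of $\ln \gamma$ are nonnegative. This follows in one direction from
  $(\gamma_n^p - 1)/p \to \ln \gamma_n$ as $p$ tends to 0 (\<open>log_completely_monotone_from_powers\<close>),
  and in the other from $\gamma_n^p = \lim_N (1 + p \ln \gamma_n / N)^N$, because products of
  completely monotone sequences are completely monotone (\<open>completely_monotone_exp\<close>).

  Both directions of Berger's theorem are proved without measures. For a normal operator $N$ and a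
  vector $w$ with bounded orbit, the sequence $\|N^iw\|^2$ is completely monotone, since replacing
  $w$ by $w - N^*Nw$ takes second differences (\<open>normal_orbit_completely_monotone\<close>). Conversely,
  for completely monotone moments $g$, the Gram matrix that the functions $z^a \bar z^b$ would have
  in $L^2$ of the rotation invariant measure with $\int |z|^{2n} = g_n$ can be written down
  directly. It is positive semidefinite, as a limit of positive combinations of the Gram matrices
  for circles (\<open>positive_shift_kernel\<close>). A Cholesky factorization realizes it by vectors in the
  space of square-summable sequences, in such a way that the powers $z^n$ become multiples of unit
  vectors, and multiplication by $z$ becomes a normal contraction, given by a matrix with finite
  rows and columns (\<open>kernel_shift_matrix\<close>). It extends the weighted shift
  (\<open>completely_monotone_shift_subnormal\<close>).
\<close>

section \<open>Finite differences and completely monotone sequences\<close>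

text \<open>
  The sign is the one for which $t^k$ with $0 \le t \le 1$ has nonnegative differences:
  $(1-E)^n a$ with the shift $E$. The recursion differences the sequence first, so that an
  induction over the order that generalizes the sequence needs no commutation rule.
\<close>

fun bdiff :: "nat \<Rightarrow> (nat \<Rightarrow> real) \<Rightarrow> nat \<Rightarrow> real" where
  "bdiff 0 a k = a k"
| "bdiff (Suc n) a k = bdiff n (\<lambda>j. a j - a (Suc j)) k"

lemma bdiff_shift: "bdiff n (\<lambda>j. a (Suc j)) k = bdiff n a (Suc k)"
  by (induction n arbitrary: a) auto

lemma bdiff_add: "bdiff n (\<lambda>j. a j + b j) k = bdiff n a k + bdiff n b k"
proof (induction n arbitrary: a b)
  case (Suc n)
  have "bdiff (Suc n) (\<lambda>j. a j + b j) k = bdiff n (\<lambda>j. (a j - a (Suc j)) + (b j - b (Suc j))) k"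
    by (simp add: algebra_simps)
  then show ?case by (simp only: Suc.IH bdiff.simps)
qed simp

lemma bdiff_cmult: "bdiff n (\<lambda>j. c * a j) k = c * bdiff n a k"
  by (induction n arbitrary: a) (simp_all flip: right_diff_distrib)

lemma bdiff_Suc: "bdiff (Suc n) a k = bdiff n a k - bdiff n a (Suc k)"
  using bdiff_add[of n a "\<lambda>j. (-1) * a (Suc j)" k]
    bdiff_cmult[of n "-1" "\<lambda>j. a (Suc j)" k] by (simp add: bdiff_shift)

lemma bdiff_const: "bdiff n (\<lambda>j. c) k = (if n = 0 then c else 0)"
proof (induction n)
  case (Suc n)
  then show ?case by (cases n) (auto simp: bdiff_Suc)
qed simp

lemma bdiff_eq_sum:
  "bdiff n a k = (\<Sum>i=0..n. (-1) ^ i * real (n choose i) * a (k + i))"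
proof (induction n arbitrary: k)
  case (Suc n)
  have "(\<Sum>i=0..Suc n. (-1) ^ i * real (Suc n choose i) * a (k + i)) =
        a k + (\<Sum>i=0..n. (-1) ^ Suc i * real (Suc n choose Suc i) * a (k + Suc i))"
    by (simp add: sum.atLeast0_atMost_Suc_shift del: sum.cl_ivl_Suc binomial_Suc_Suc)
  also have "(\<Sum>i=0..n. (-1) ^ Suc i * real (Suc n choose Suc i) * a (k + Suc i)) =
     (\<Sum>i=0..n. (-1) ^ Suc i * real (n choose Suc i) * a (k + Suc i)) -
     (\<Sum>i=0..n. (-1) ^ i * real (n choose i) * a (Suc k + i))"
    by (subst sum_subtractf[symmetric], intro sum.cong) (simp_all add: algebra_simps)
  also have "a k + ((\<Sum>i=0..n. (-1) ^ Suc i * real (n choose Suc i) * a (k + Suc i)) -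
     (\<Sum>i=0..n. (-1) ^ i * real (n choose i) * a (Suc k + i))) =
     (\<Sum>i=0..Suc n. (-1) ^ i * real (n choose i) * a (k + i)) -
     (\<Sum>i=0..n. (-1) ^ i * real (n choose i) * a (Suc k + i))"
    by (subst sum.atLeast0_atMost_Suc_shift) simp
  also have "(\<Sum>i=0..Suc n. (-1) ^ i * real (n choose i) * a (k + i)) =
     (\<Sum>i=0..n. (-1) ^ i * real (n choose i) * a (k + i))" by (simp add: binomial_eq_0)
  finally show ?case using Suc.IH by (simp add: bdiff_Suc del: bdiff.simps)
qed simp

lemma tendsto_bdiff:
  assumes "\<And>j. ((\<lambda>N. a N j) \<longlongrightarrow> b j) F"
  shows "((\<lambda>N. bdiff n (a N) k) \<longlongrightarrow> bdiff n b k) F"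
  unfolding bdiff_eq_sum by (intro tendsto_intros assms)

text \<open>
  The horizon matters because the sequences $1 + p a_j/N$ that approximate $e^{p a_j}$ are
  nonnegative only for $j$ up to some bound that grows with $N$. A difference of order $n$ at $k$
  sees the indices $k, \dots, k+n$ only.
\<close>

definition completely_monotone_upto :: "nat \<Rightarrow> (nat \<Rightarrow> real) \<Rightarrow> bool"
  where "completely_monotone_upto K a \<longleftrightarrow> (\<forall>n k. n + k \<le> K \<longrightarrow> bdiff n a k \<ge> 0)"

definition completely_monotone :: "(nat \<Rightarrow> real) \<Rightarrow> bool"
  where "completely_monotone a \<longleftrightarrow> (\<forall>n k. bdiff n a k \<ge> 0)"

lemma completely_monotone_upto_mono:
  "completely_monotone_upto K a \<Longrightarrow> L \<le> K \<Longrightarrow> completely_monotone_upto L a"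
  by (auto simp: completely_monotone_upto_def)

lemma completely_monotone_upto_Suc:
  assumes "completely_monotone_upto (Suc K) a"
  shows "completely_monotone_upto K (\<lambda>j. a (Suc j))"
    and "completely_monotone_upto K (\<lambda>j. a j - a (Suc j))"
  using assms unfolding completely_monotone_upto_def bdiff_shift
  by (metis add_Suc_right Suc_le_mono) (metis add_Suc Suc_le_mono bdiff.simps(2) assms completely_monotone_upto_def)

text \<open>
  Induction over the order by the discrete Leibniz rule
  $\Delta(ab)_j = (\Delta a)_j\, b_j + a_{j+1}\, (\Delta b)_j$, whose factors are again completely
  monotone up to a horizon that is smaller by one.
\<close>

lemma completely_monotone_upto_mult:
  assumes "completely_monotone_upto K a" "completely_monotone_upto K b"
  shows "completely_monotone_upto K (\<lambda>j. a j * b j)"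
proof -
  have "bdiff n (\<lambda>j. a j * b j) k \<ge> 0"
    if "completely_monotone_upto K a" "completely_monotone_upto K b" "n + k \<le> K" for n k K a b
    using that
  proof (induction n arbitrary: a b K)
    case 0
    have "a k \<ge> 0" "b k \<ge> 0"
      using 0 unfolding completely_monotone_upto_def by (metis add_0 bdiff.simps(1))+
    then show ?case by simp
  next
    case (Suc n)
    then obtain L where K: "K = Suc L" by (cases K) auto
    note a = completely_monotone_upto_Suc[OF Suc.prems(1)[unfolded K]]
    note b = completely_monotone_upto_Suc[OF Suc.prems(2)[unfolded K]]
    have b': "completely_monotone_upto L b"
      using Suc.prems(2) K by (auto intro: completely_monotone_upto_mono)
    have "bdiff (Suc n) (\<lambda>j. a j * b j) k =
        bdiff n (\<lambda>j. (a j - a (Suc j)) * b j + a (Suc j) * (b j - b (Suc j))) k"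
      by (simp add: algebra_simps)
    also have "\<dots> = bdiff n (\<lambda>j. (a j - a (Suc j)) * b j) k
        + bdiff n (\<lambda>j. a (Suc j) * (b j - b (Suc j))) k"
      by (rule bdiff_add)
    also have "\<dots> \<ge> 0"
      using Suc.IH[OF a(2) b'] Suc.IH[OF a(1) b(2)] Suc.prems(3) K by simp
    finally show ?case .
  qed
  then show ?thesis using assms unfolding completely_monotone_upto_def by blast
qed

lemma completely_monotone_upto_power:
  assumes "completely_monotone_upto K a"
  shows "completely_monotone_upto K (\<lambda>j. a j ^ m)"
proof (induction m)
  case 0
  show ?case by (simp add: completely_monotone_upto_def bdiff_const)
next
  case (Suc m)
  then show ?case using completely_monotone_upto_mult[OF assms] by simp
qed

section \<open>Exponentials\<close>

text \<open>
  This is Euler's limit $e^{p a_j} = \lim_N (1 + p a_j/N)^N$. Adding the constant 1 does not change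
  differences of positive order, so $1 + p a_j/N$ is completely monotone up to any given horizon as
  soon as $N$ makes it nonnegative there; powers and pointwise limits preserve this.
\<close>

lemma completely_monotone_exp:
  assumes "\<And>n k. n \<ge> 1 \<Longrightarrow> bdiff n a k \<ge> 0" and p: "p \<ge> 0"
  shows "completely_monotone (\<lambda>j. exp (p * a j))"
  unfolding completely_monotone_def
proof (intro allI)
  fix n k :: nat
  define K where "K = n + k"
  have ev: "eventually (\<lambda>N. bdiff n (\<lambda>j. (1 + p * a j / real N) ^ N) k \<ge> 0) sequentially"
  proof -
    have "eventually (\<lambda>N. \<forall>j\<le>K. \<bar>p * a j\<bar> \<le> real N) sequentially"
    proof -
      obtain N0 :: nat where N0: "real N0 \<ge> (\<Sum>j\<le>K. \<bar>p * a j\<bar>)" using real_arch_simple by blast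
      have "\<bar>p * a j\<bar> \<le> real N" if "N \<ge> N0" "j \<le> K" for N j
        using member_le_sum[of j "{..K}" "\<lambda>j. \<bar>p * a j\<bar>"] N0 that by auto
      then show ?thesis unfolding eventually_sequentially by blast
    qed
    then show ?thesis using eventually_gt_at_top[of 0]
    proof eventually_elim
      case (elim N)
      have nonneg: "1 + p * a j / real N \<ge> 0" if "j \<le> K" for j
        using elim that by (auto simp: field_simps abs_le_iff)
      have "completely_monotone_upto K (\<lambda>j. 1 + p * a j / real N)"
        unfolding completely_monotone_upto_def
      proof (intro allI impI)
        fix m l assume ml: "m + l \<le> K"
        show "bdiff m (\<lambda>j. 1 + p * a j / real N) l \<ge> 0"
        proof (cases m)
          case 0
          then show ?thesis using nonneg[of l] ml by simp
        next
          case (Suc m')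
          have "bdiff m (\<lambda>j. 1 + p * a j / real N) l = (p / real N) * bdiff m a l"
            using bdiff_add[of m "\<lambda>_. 1" "\<lambda>j. (p / real N) * a j" l]
              bdiff_cmult[of m "p / real N" a l] Suc
            by (simp add: bdiff_const del: bdiff.simps)
          then show ?thesis using assms(1)[of m l] p Suc by (simp del: bdiff.simps)
        qed
      qed
      then have "completely_monotone_upto K (\<lambda>j. (1 + p * a j / real N) ^ N)"
        by (rule completely_monotone_upto_power)
      then show ?case unfolding completely_monotone_upto_def K_def by simp
    qed
  qed
  have "(\<lambda>N. bdiff n (\<lambda>j. (1 + p * a j / real N) ^ N) k) \<longlonglongrightarrow> bdiff n (\<lambda>j. exp (p * a j)) k"
    by (intro tendsto_bdiff tendsto_exp_limit_sequentially)
  then show "bdiff n (\<lambda>j. exp (p * a j)) k \<ge> 0"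
    using ev by (rule tendsto_lowerbound) simp
qed

text \<open>
  The derivative of $e^{pL}$ at $p = 0$. It is what turns information on all small powers of a
  sequence into information on its logarithm.
\<close>

lemma log_limit: "((\<lambda>p. (exp (p * L) - 1) / p) \<longlongrightarrow> (L::real)) (at_right 0)"
proof -
  have "((\<lambda>p. exp (p * L)) has_real_derivative L) (at 0)"
    by (auto intro!: derivative_eq_intros)
  then show ?thesis
    unfolding DERIV_def by (auto intro: tendsto_mono[OF at_le])
qed

lemma log_completely_monotone_iff:
  "log_completely_monotone g \<longleftrightarrow> (\<forall>n\<ge>1. \<forall>k. bdiff n (\<lambda>j. ln (g j)) k \<ge> 0)"
  by (simp add: log_completely_monotone_def bdiff_eq_sum)

text \<open>
  A difference of positive order does not see the constant 1, hence it is nonnegative on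
  $(e^{p a_j} - 1)/p$, and this tends to $a_j$ as $p$ decreases to 0.
\<close>

lemma log_completely_monotone_from_powers:
  assumes "\<And>p. p > 0 \<Longrightarrow> completely_monotone (\<lambda>j. exp (p * a j))" and n: "n \<ge> 1"
  shows "bdiff n a k \<ge> 0"
proof -
  have lim: "((\<lambda>p. bdiff n (\<lambda>j. (exp (p * a j) - 1) / p) k) \<longlongrightarrow> bdiff n a k) (at_right 0)"
    by (intro tendsto_bdiff log_limit)
  have "bdiff n (\<lambda>j. (exp (p * a j) - 1) / p) k \<ge> 0" if "p > 0" for p
  proof -
    have "bdiff n (\<lambda>j. (exp (p * a j) - 1) / p) k = (1 / p) * bdiff n (\<lambda>j. exp (p * a j)) k"
      using bdiff_cmult[of n "1 / p" "\<lambda>j. exp (p * a j) + (- 1)" k] n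
        bdiff_add[of n "\<lambda>j. exp (p * a j)" "\<lambda>_. - 1" k] by (simp add: bdiff_const)
    then show ?thesis using assms(1)[OF that] that by (simp add: completely_monotone_def)
  qed
  then have "\<forall>\<^sub>F p in at_right 0. bdiff n (\<lambda>j. (exp (p * a j) - 1) / p) k \<ge> 0"
    by (simp add: eventually_at_right_less eventually_mono[OF eventually_at_right_less])
  then show ?thesis by (rule tendsto_lowerbound[OF lim]) simp
qed

section \<open>Bernstein sums\<close>

text \<open>
  The binomial expansion of $1 = ((1-E) + E)^N$ with the shift $E$.
\<close>

lemma bernstein_weights_sum:
  "(\<Sum>j\<le>N. real (N choose j) * bdiff (N - j) a (k + j)) = a k"
proof (induction N arbitrary: a k)
  case (Suc N)
  have "(\<Sum>j\<le>Suc N. real (Suc N choose j) * bdiff (Suc N - j) a (k + j)) =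
     bdiff (Suc N) a k + (\<Sum>j\<le>N. real (Suc N choose Suc j) * bdiff (N - j) a (k + Suc j))"
    by (simp only: sum.atMost_Suc_shift) simp
  also have "(\<Sum>j\<le>N. real (Suc N choose Suc j) * bdiff (N - j) a (k + Suc j)) =
     (\<Sum>j\<le>N. real (N choose j) * bdiff (N - j) a (Suc k + j)) +
     (\<Sum>j\<le>N. real (N choose Suc j) * bdiff (Suc N - Suc j) a (k + Suc j))"
    by (simp add: sum.distrib[symmetric] algebra_simps)
  also have "(\<Sum>j\<le>N. real (N choose j) * bdiff (N - j) a (Suc k + j)) = a (Suc k)"
    by (rule Suc.IH)
  also have "bdiff (Suc N) a k + (a (Suc k) +
      (\<Sum>j\<le>N. real (N choose Suc j) * bdiff (Suc N - Suc j) a (k + Suc j)))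
    = a (Suc k) + (\<Sum>j\<le>Suc N. real (N choose j) * bdiff (Suc N - j) a (k + j))"
    by (subst sum.atMost_Suc_shift) simp
  also have "(\<Sum>j\<le>Suc N. real (N choose j) * bdiff (Suc N - j) a (k + j))
    = (\<Sum>j\<le>N. real (N choose j) * bdiff (N - j) (\<lambda>j. a j - a (Suc j)) (k + j))"
    by (simp add: binomial_eq_0 Suc_diff_le)
  also have "\<dots> = a k - a (Suc k)"
    by (rule Suc.IH)
  finally show ?case by simp
qed simp

text \<open>
  The $n$-th moment of the measure on $[0,1]$ with mass $\binom{N}{j} \Delta^{N-j} a_j$ at the point
  $j/N$. For completely monotone $a$ this measure is positive, and for $N \to \infty$ these
  measures converge weakly to the solution of Hausdorff's moment problem for $a$. Only the
  convergence of their moments matters here.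
\<close>

definition bernstein_moment :: "(nat \<Rightarrow> real) \<Rightarrow> nat \<Rightarrow> nat \<Rightarrow> real"
  where "bernstein_moment a N n =
    (\<Sum>j\<le>N. (real j / real N) ^ n * (real (N choose j) * bdiff (N - j) a j))"

lemma completely_monotone_shift:
  "completely_monotone a \<Longrightarrow> completely_monotone (\<lambda>j. a (Suc j))"
  by (auto simp: completely_monotone_def bdiff_shift)

lemma completely_monotone_diff:
  "completely_monotone a \<Longrightarrow> completely_monotone (\<lambda>j. a j - a (Suc j))"
  unfolding completely_monotone_def by (metis bdiff.simps(2))

text \<open>
  Absorbing a factor $j/N$ into the binomial coefficient lowers $N$ and $n$ by one and shifts the
  sequence, except that the remaining powers are still taken of $(i+1)/(N+1)$ instead of $i/N$.
\<close>

lemma bernstein_moment_Suc: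
  "bernstein_moment a (Suc N) (Suc n) =
    (\<Sum>i\<le>N. (real (Suc i) / real (Suc N)) ^ n * (real (N choose i) * bdiff (N - i) (\<lambda>j. a (Suc j)) i))"
proof -
  have *: "real (Suc i) / real (Suc N) * real (Suc N choose Suc i) = real (N choose i)" for i
    using Suc_times_binomial_eq[of N i] 
    by (simp add: field_simps del: binomial_Suc_Suc of_nat_Suc flip: of_nat_mult)
  have "bernstein_moment a (Suc N) (Suc n) =
    (\<Sum>i\<le>N. (real (Suc i) / real (Suc N)) ^ n * ((real (Suc i) / real (Suc N) * real (Suc N choose Suc i))
       * bdiff (N - i) a (Suc i)))"
    unfolding bernstein_moment_def
    by (subst sum.atMost_Suc_shift) (simp add: mult_ac del: of_nat_Suc binomial_Suc_Suc)
  then show ?thesis by (simp only: * bdiff_shift)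
qed

text \<open>
  The points $(i+1)/(N+1)$ and $i/N$ differ by at most $1/(N+1)$, and $t^n$ is Lipschitz on $[0,1]$
  with constant $n$.
\<close>

lemma bernstein_moment_step:
  assumes "completely_monotone a" "N \<ge> 1"
  shows "\<bar>bernstein_moment a (Suc N) (Suc n) - bernstein_moment (\<lambda>j. a (Suc j)) N n\<bar>
    \<le> real n / real (Suc N) * a 1"
proof -
  let ?w = "\<lambda>i. real (N choose i) * bdiff (N - i) (\<lambda>j. a (Suc j)) i"
  have w: "?w i \<ge> 0" for i
    using completely_monotone_shift[OF assms(1)] by (simp add: completely_monotone_def)
  have d: "\<bar>(real (Suc i) / real (Suc N)) ^ n - (real i / real N) ^ n\<bar> \<le> real n / real (Suc N)"
    if "i \<le> N" for i
  proof -
    have "\<bar>(real (Suc i) / real (Suc N)) ^ n - (real i / real N) ^ n\<bar>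
       \<le> real n * \<bar>real (Suc i) / real (Suc N) - real i / real N\<bar>"
      using norm_power_diff[of "real (Suc i) / real (Suc N)" "real i / real N" n] that assms(2)
      by simp
    also have "real (Suc i) / real (Suc N) - real i / real N = (real N - real i) / (real N * real (Suc N))"
      using assms(2) by (simp add: field_simps)
    also have "\<bar>(real N - real i) / (real N * real (Suc N))\<bar> \<le> real N / (real N * real (Suc N))"
      using that by (subst abs_of_nonneg, simp) (intro divide_right_mono, auto)
    also have "\<dots> = 1 / real (Suc N)" using assms(2) by simp
    finally show ?thesis by (simp add: mult_left_mono)
  qed
  have "\<bar>bernstein_moment a (Suc N) (Suc n) - bernstein_moment (\<lambda>j. a (Suc j)) N n\<bar> =
     \<bar>\<Sum>i\<le>N. ((real (Suc i) / real (Suc N)) ^ n - (real i / real N) ^ n) * ?w i\<bar>"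
    unfolding bernstein_moment_Suc unfolding bernstein_moment_def
    by (simp add: sum_subtractf left_diff_distrib)
  also have "\<dots> \<le> (\<Sum>i\<le>N. \<bar>((real (Suc i) / real (Suc N)) ^ n - (real i / real N) ^ n) * ?w i\<bar>)"
    by (rule sum_abs)
  also have "\<dots> \<le> (\<Sum>i\<le>N. real n / real (Suc N) * ?w i)"
  proof (rule sum_mono)
    fix i assume "i \<in> {..N}"
    then show "\<bar>((real (Suc i) / real (Suc N)) ^ n - (real i / real N) ^ n) * ?w i\<bar>
      \<le> real n / real (Suc N) * ?w i"
      unfolding abs_mult[of _ "?w i"] abs_of_nonneg[OF w]
      by (intro mult_right_mono d w) auto
  qed
  also have "\<dots> = real n / real (Suc N) * a 1"
    using bernstein_weights_sum[of N "\<lambda>j. a (Suc j)" 0] by (simp only: sum_distrib_left[symmetric]) simp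
  finally show ?thesis .
qed

lemma bernstein_moment_tendsto:
  assumes "completely_monotone a"
  shows "(\<lambda>N. bernstein_moment a N n) \<longlonglongrightarrow> a n"
  using assms
proof (induction n arbitrary: a)
  case 0
  then show ?case using bernstein_weights_sum[of _ a 0] by (simp add: bernstein_moment_def)
next
  case (Suc n)
  let ?b = "\<lambda>j. a (Suc j)"
  have lim: "(\<lambda>N. real n / real (Suc N) * a 1) \<longlonglongrightarrow> 0"
    using tendsto_mult_right[OF LIMSEQ_inverse_real_of_nat, of "real n * a 1"]
    by (simp add: field_simps)
  have "(\<lambda>N. bernstein_moment a (Suc N) (Suc n) - bernstein_moment ?b N n) \<longlonglongrightarrow> 0"
    by (rule Lim_null_comparison[OF _ lim])
      (use bernstein_moment_step[OF Suc.prems] in \<open>auto simp: eventually_sequentially simp del: of_nat_Suc\<close>)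
  from tendsto_add[OF this Suc.IH[OF completely_monotone_shift[OF Suc.prems]]]
  have "(\<lambda>N. bernstein_moment a (Suc N) (Suc n)) \<longlonglongrightarrow> a (Suc n)" by simp
  then show ?case by (rule LIMSEQ_imp_Suc)
qed

section \<open>The kernel of a rotation invariant measure\<close>

definition positive_kernel :: "('i \<Rightarrow> 'i \<Rightarrow> real) \<Rightarrow> bool"
  where "positive_kernel k \<longleftrightarrow> (\<forall>F c. finite F \<longrightarrow> (\<Sum>i\<in>F. \<Sum>j\<in>F. c i * c j * k i j) \<ge> 0)"

lemma positive_kernelD:
  "positive_kernel k \<Longrightarrow> finite F \<Longrightarrow> 0 \<le> (\<Sum>i\<in>F. \<Sum>j\<in>F. c i * c j * k i j)"
  by (simp add: positive_kernel_def)

lemma positive_kernel_pullback: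
  fixes f :: "'j \<Rightarrow> 'i"
  assumes "positive_kernel k" "inj f"
  shows "positive_kernel (\<lambda>i j. k (f i) (f j))"
  unfolding positive_kernel_def
proof (intro allI impI)
  fix F :: "'j set" and c assume "finite F"
  have inj: "inj_on f F" using assms(2) by (rule inj_on_subset) simp
  have "0 \<le> (\<Sum>i\<in>f ` F. \<Sum>j\<in>f ` F. c (inv_into UNIV f i) * c (inv_into UNIV f j) * k i j)"
    by (rule positive_kernelD[OF assms(1)]) (simp add: \<open>finite F\<close>)
  then show "0 \<le> (\<Sum>i\<in>F. \<Sum>j\<in>F. c i * c j * k (f i) (f j))"
    by (simp add: sum.reindex[OF inj] inv_f_f[OF assms(2)])
qed

text \<open>
  If $g_n = \int |z|^{2n}\,d\nu$ for a rotation invariant measure $\nu$ on the unit disc, then this is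
  the inner product of $z^a \bar z^b$ and $z^c \bar z^d$ in $L^2(\nu)$, where the index $(a,b)$
  stands for $z^a \bar z^b$: the angular integral vanishes unless $a + d = b + c$. The space
  $L^2(\nu)$ with multiplication by $z$ is the minimal normal extension of the weighted shift with
  moments $g$. Working with the kernel alone makes the measure unnecessary.
\<close>

definition shift_kernel :: "(nat \<Rightarrow> real) \<Rightarrow> nat \<times> nat \<Rightarrow> nat \<times> nat \<Rightarrow> real"
  where "shift_kernel g x y =
    (if fst x + snd y = snd x + fst y then g (fst x + snd y) else 0)"

text \<open>
  The kernel is block diagonal, one block for each value $m$ of $h$, and each block contributes
  the square of the sum of the $u_i$ with $h(i) = m$.
\<close>

lemma positive_kernel_of_eq:
  fixes u :: "'i \<Rightarrow> real"
  assumes F: "finite F"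
  shows "(\<Sum>i\<in>F. \<Sum>j\<in>F. if h i = h j then u i * u j else 0) \<ge> 0"
proof -
  have "(\<Sum>i\<in>F. \<Sum>j\<in>F. if h i = h j then u i * u j else 0) =
     (\<Sum>i\<in>F. \<Sum>j\<in>F. \<Sum>m\<in>h ` F. (if h i = m then u i else 0) * (if h j = m then u j else 0))"
  proof (intro sum.cong refl)
    fix i j assume "i \<in> F" "j \<in> F"
    have "(\<Sum>m\<in>h ` F. (if h i = m then u i else 0) * (if h j = m then u j else 0)) =
      (\<Sum>m\<in>h ` F. if h i = m then (if h i = h j then u i * u j else 0) else 0)"
      by (intro sum.cong) auto
    then show "(if h i = h j then u i * u j else 0) =
      (\<Sum>m\<in>h ` F. (if h i = m then u i else 0) * (if h j = m then u j else 0))"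
      using F \<open>i \<in> F\<close> by (simp add: sum.delta)
  qed
  also have "\<dots> = (\<Sum>m\<in>h ` F. \<Sum>i\<in>F. \<Sum>j\<in>F. (if h i = m then u i else 0) * (if h j = m then u j else 0))"
    by (subst (2) sum.swap, subst sum.swap) simp
  also have "\<dots> = (\<Sum>m\<in>h ` F. (\<Sum>i\<in>F. if h i = m then u i else 0)\<^sup>2)"
    by (simp only: power2_eq_square sum_product)
  also have "\<dots> \<ge> 0" by (intro sum_nonneg) simp
  finally show ?thesis .
qed

text \<open>
  The case of the uniform measure on the circle of radius $s = \sqrt t$: since
  $2(a+d) = (a+b)+(c+d)$ when $a + d = b + c$, the kernel factors into $s^{a+b} s^{c+d}$ on the
  pairs with equal winding number $a - b = c - d$.
\<close>

lemma positive_shift_kernel_power: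
  assumes "t \<ge> 0"
  shows "positive_kernel (shift_kernel (\<lambda>n. t ^ n))"
  unfolding positive_kernel_def
proof (intro allI impI)
  fix F :: "(nat \<times> nat) set" and c assume F: "finite F"
  define u where "u x = c x * sqrt t ^ (fst x + snd x)" for x
  define h where "h x = int (fst x) - int (snd x)" for x :: "nat \<times> nat"
  have "c x * c y * shift_kernel (\<lambda>n. t ^ n) x y = (if h x = h y then u x * u y else 0)" for x y
  proof (cases "h x = h y")
    case True
    then have e: "fst x + snd y = snd x + fst y" unfolding h_def by linarith
    have "t ^ (fst x + snd y) = sqrt t ^ (2 * (fst x + snd y))"
      using real_sqrt_pow2[OF assms] by (simp only: power_mult)
    also have "2 * (fst x + snd y) = (fst x + snd x) + (fst y + snd y)" using e by arith
    finally show ?thesis using True e by (simp add: shift_kernel_def u_def power_add)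
  next
    case False
    then have "fst x + snd y \<noteq> snd x + fst y" unfolding h_def by linarith
    then show ?thesis using False by (simp add: shift_kernel_def)
  qed
  then show "(\<Sum>i\<in>F. \<Sum>j\<in>F. c i * c j * shift_kernel (\<lambda>n. t ^ n) i j) \<ge> 0"
    using positive_kernel_of_eq[OF F, of h u] by simp
qed

text \<open>
  The kernel is linear in $g$. The Bernstein moments of $g$ are positive combinations of powers
  $t^n$, and they converge to $g$.
\<close>

lemma positive_shift_kernel:
  assumes "completely_monotone g"
  shows "positive_kernel (shift_kernel g)"
  unfolding positive_kernel_def
proof (intro allI impI)
  fix F :: "(nat \<times> nat) set" and c assume F: "finite F"
  have lim: "(\<lambda>N. \<Sum>i\<in>F. \<Sum>j\<in>F. c i * c j * shift_kernel (bernstein_moment g N) i j) \<longlonglongrightarrow>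
     (\<Sum>i\<in>F. \<Sum>j\<in>F. c i * c j * shift_kernel g i j)"
    unfolding shift_kernel_def
    by (intro tendsto_sum tendsto_mult tendsto_const)
      (auto intro: bernstein_moment_tendsto[OF assms])
  have pos: "(\<Sum>i\<in>F. \<Sum>j\<in>F. c i * c j * shift_kernel (bernstein_moment g N) i j) \<ge> 0" for N
  proof -
    let ?w = "\<lambda>l. real (N choose l) * bdiff (N - l) g l"
    let ?k = "\<lambda>l. shift_kernel (\<lambda>n. (real l / real N) ^ n)"
    have "(\<Sum>i\<in>F. \<Sum>j\<in>F. c i * c j * shift_kernel (bernstein_moment g N) i j) =
      (\<Sum>i\<in>F. \<Sum>j\<in>F. \<Sum>l\<le>N. ?w l * (c i * c j * ?k l i j))"
    proof (intro sum.cong refl)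
      fix i j 
      have "shift_kernel (bernstein_moment g N) i j = (\<Sum>l\<le>N. ?k l i j * ?w l)"
        by (auto simp: shift_kernel_def bernstein_moment_def)
      then show "c i * c j * shift_kernel (bernstein_moment g N) i j = (\<Sum>l\<le>N. ?w l * (c i * c j * ?k l i j))"
        by (simp add: sum_distrib_left mult_ac)
    qed
    also have "\<dots> = (\<Sum>l\<le>N. \<Sum>i\<in>F. \<Sum>j\<in>F. ?w l * (c i * c j * ?k l i j))"
      by (subst (2) sum.swap, subst sum.swap) simp
    also have "\<dots> = (\<Sum>l\<le>N. ?w l * (\<Sum>i\<in>F. \<Sum>j\<in>F. c i * c j * ?k l i j))"
      by (simp add: sum_distrib_left)
    also have "\<dots> \<ge> 0"
    proof (rule sum_nonneg, rule mult_nonneg_nonneg[OF mult_nonneg_nonneg])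
      fix l
      show "bdiff (N - l) g l \<ge> 0" using assms by (simp add: completely_monotone_def)
      show "(\<Sum>i\<in>F. \<Sum>j\<in>F. c i * c j * ?k l i j) \<ge> 0"
        using positive_shift_kernel_power[of "real l / real N"] F by (simp add: positive_kernel_def)
    qed simp
    finally show ?thesis .
  qed
  show "(\<Sum>i\<in>F. \<Sum>j\<in>F. c i * c j * shift_kernel g i j) \<ge> 0"
    by (rule tendsto_lowerbound[OF lim]) (auto simp: pos)
qed

section \<open>Triangular factorization of positive kernels\<close>

definition symmetric_kernel :: "('i \<Rightarrow> 'i \<Rightarrow> real) \<Rightarrow> bool"
  where "symmetric_kernel k \<longleftrightarrow> (\<forall>i j. k i j = k j i)"

text \<open>
  One step of the Cholesky algorithm, that is, the Schur complement with pivot $r$. If the pivot is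
  zero, division by zero leaves the kernel unchanged, which is right because a positive kernel
  then has a zero row there.
\<close>

definition deflate :: "('i \<Rightarrow> 'i \<Rightarrow> real) \<Rightarrow> 'i \<Rightarrow> 'i \<Rightarrow> 'i \<Rightarrow> real"
  where "deflate k r i j = k i j - k i r * k j r / k r r"

lemma symmetric_deflate: "symmetric_kernel k \<Longrightarrow> symmetric_kernel (deflate k r)"
  by (auto simp: symmetric_kernel_def deflate_def)

lemma positive_kernel_diag: "positive_kernel k \<Longrightarrow> k r r \<ge> 0"
  using positive_kernelD[of k "{r}" "\<lambda>_. 1"] by simp

text \<open>
  Subtracting from $c$ the multiple $s$ of the unit vector at $r$ that minimizes the quadratic form
  of $k$ yields the value of the form of the deflated kernel at $c$.
\<close>

lemma positive_deflate:
  fixes k :: "'i \<Rightarrow> 'i \<Rightarrow> real"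
  assumes pos: "positive_kernel k" and sym: "symmetric_kernel k"
  shows "positive_kernel (deflate k r)"
proof (cases "k r r = 0")
  case True
  then show ?thesis using pos by (simp add: deflate_def[abs_def])
next
  case False
  show ?thesis unfolding positive_kernel_def
  proof (intro allI impI)
    fix F :: "'i set" and c :: "'i \<Rightarrow> real" assume F: "finite F"
    \<comment> \<open>The pivot may lie outside of \<open>F\<close>, so the competing vector needs a larger support.\<close>
    define F' where "F' = insert r F"
    define c' where "c' i = (if i \<in> F then c i else 0)" for i
    define B where "B = (\<Sum>i\<in>F'. c' i * k i r)"
    define s where "s = B / k r r"
    define d where "d i = (if i = r then s else 0)" for i
    have F': "finite F'" "r \<in> F'" using F by (auto simp: F'_def)
    have restrict: "(\<Sum>i\<in>F'. c' i * f i) = (\<Sum>i\<in>F. c i * f i)" for f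
      by (rule sum.mono_neutral_cong_right) (use F in \<open>auto simp: F'_def c'_def\<close>)
    have d_sum: "(\<Sum>i\<in>F'. d i * f i) = s * f r" for f
    proof -
      have "(\<Sum>i\<in>F'. d i * f i) = (\<Sum>i\<in>F'. if i = r then s * f i else 0)"
        by (intro sum.cong) (auto simp: d_def)
      then show ?thesis using F' by simp
    qed
    define X where "X i = (\<Sum>j\<in>F'. c' j * k i j) - s * k i r" for i
    have "0 \<le> (\<Sum>i\<in>F'. \<Sum>j\<in>F'. (c' i - d i) * (c' j - d j) * k i j)"
      by (rule positive_kernelD[OF pos F'(1)])
    also have "\<dots> = (\<Sum>i\<in>F'. (c' i - d i) * X i)"
    proof (intro sum.cong refl)
      fix i
      have "(\<Sum>j\<in>F'. (c' i - d i) * (c' j - d j) * k i j) =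
          (c' i - d i) * (\<Sum>j\<in>F'. c' j * k i j - d j * k i j)"
        unfolding sum_distrib_left by (intro sum.cong refl) (simp add: left_diff_distrib right_diff_distrib mult_ac)
      then show "(\<Sum>j\<in>F'. (c' i - d i) * (c' j - d j) * k i j) = (c' i - d i) * X i"
        by (simp add: sum_subtractf d_sum X_def)
    qed
    also have "\<dots> = (\<Sum>i\<in>F'. c' i * X i) - s * X r"
      by (simp only: left_diff_distrib sum_subtractf d_sum)
    also have "(\<Sum>i\<in>F'. c' i * X i) = (\<Sum>i\<in>F'. c' i * (\<Sum>j\<in>F'. c' j * k i j)) - s * B"
      by (simp add: X_def right_diff_distrib sum_subtractf B_def sum_distrib_left[of s] mult_ac)
    also have "X r = (\<Sum>j\<in>F'. c' j * k r j) - s * k r r" by (simp add: X_def)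
    also have "(\<Sum>j\<in>F'. c' j * k r j) = B"
      unfolding B_def using sym by (metis symmetric_kernel_def)
    also have "s * k r r = B" using False by (simp add: s_def)
    also have "(\<Sum>i\<in>F'. c' i * (\<Sum>j\<in>F'. c' j * k i j)) - s * B - s * (B - B)
       = (\<Sum>i\<in>F. c i * (\<Sum>j\<in>F. c j * k i j)) - B * B / k r r"
      by (simp add: s_def restrict)
    also have "B * B = (\<Sum>i\<in>F. c i * k i r) * (\<Sum>j\<in>F. c j * k j r)"
      by (simp add: B_def restrict)
    also have "(\<Sum>i\<in>F. c i * (\<Sum>j\<in>F. c j * k i j)) - (\<Sum>i\<in>F. c i * k i r) * (\<Sum>j\<in>F. c j * k j r) / k r r
       = (\<Sum>i\<in>F. \<Sum>j\<in>F. c i * c j * deflate k r i j)"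
      by (simp add: deflate_def sum_product sum_distrib_left sum_subtractf sum_divide_distrib right_diff_distrib mult_ac)
    finally show "0 \<le> (\<Sum>i\<in>F. \<Sum>j\<in>F. c i * c j * deflate k r i j)" .
  qed
qed

text \<open>
  Otherwise the quadratic form on the span of the unit vectors at $r$ and $j$ would take negative
  values, being affine in the coordinate at $r$.
\<close>

lemma positive_kernel_null:
  assumes pos: "positive_kernel k" and sym: "symmetric_kernel k" and "k r r = 0"
  shows "k r j = 0"
proof (rule ccontr)
  assume ne: "k r j \<noteq> 0"
  then have "r \<noteq> j" using assms(3) by auto
  define s where "s = - (k j j + 1) / (2 * k r j)"
  have "0 \<le> (\<Sum>i\<in>{r,j}. \<Sum>l\<in>{r,j}. (if i = r then s else 1) * (if l = r then s else 1) * k i l)"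
    by (rule positive_kernelD[OF pos, where c = "\<lambda>i. if i = r then s else 1"]) simp
  also have "\<dots> = 2 * s * k r j + k j j"
    using \<open>r \<noteq> j\<close> assms(3) sym by (auto simp: symmetric_kernel_def)
  also have "\<dots> = -1" using ne by (simp add: s_def field_simps)
  finally show False by simp
qed

primrec residual :: "(nat \<Rightarrow> nat \<Rightarrow> real) \<Rightarrow> nat \<Rightarrow> nat \<Rightarrow> nat \<Rightarrow> real" where
  "residual k 0 = k"
| "residual k (Suc n) = deflate (residual k n) n"

text \<open>
  Cholesky's factorization realizes an arbitrary positive kernel by vectors $v_i$ with finitely
  many nonzero coordinates. A pivot $0$ produces a coordinate that is unused by all the vectors. Such
  pivots do occur: for the unweighted shift, $z \bar z = 1$ on the support of the measure.
\<close>

lemma triangular_factorization: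
  assumes pos: "positive_kernel k" and sym: "symmetric_kernel k"
  obtains v :: "nat \<Rightarrow> nat \<Rightarrow> real" where
    "\<And>i n. i < n \<Longrightarrow> v i n = 0"
    "\<And>i j N. i < N \<Longrightarrow> (\<Sum>m<N. v i m * v j m) = k i j"
    "\<And>i n. v n n = 0 \<Longrightarrow> v i n = 0"
    "\<And>n. v n n \<ge> 0"
proof -
  let ?r = "residual k"
  define v where "v i n = ?r n i n / sqrt (?r n n n)" for i n
  have psd: "positive_kernel (?r n) \<and> symmetric_kernel (?r n)" for n
    by (induction n) (use assms in \<open>auto simp: positive_deflate symmetric_deflate\<close>)
  have rpos: "?r n n n \<ge> 0" for n by (rule positive_kernel_diag[OF conjunct1[OF psd]])
  have rsym: "?r n i j = ?r n j i" for n i j using psd by (simp add: symmetric_kernel_def)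
  have null: "?r n n j = 0" if "?r n n n = 0" for n j
    by (rule positive_kernel_null[OF conjunct1[OF psd] conjunct2[OF psd] that])
  have zero: "?r n i j = 0" if "i < n" for n i j
    using that
  proof (induction n arbitrary: i j)
    case (Suc n)
    show ?case
    proof (cases "i = n")
      case True
      then show ?thesis using null[of n j] rsym[of n j n]
        by (auto simp: deflate_def)
    next
      case False
      then show ?thesis using Suc by (simp add: deflate_def)
    qed
  qed simp
  have step: "v i n * v j n = ?r n i n * ?r n j n / ?r n n n" for i j n
    using rpos[of n] by (simp add: v_def)
  have expand: "(\<Sum>m<N. v i m * v j m) + ?r N i j = k i j" for i j N
    by (induction N) (auto simp: step deflate_def algebra_simps)
  show ?thesis
  proof (rule that[of v])
    show "v i n = 0" if "i < n" for i n using that zero by (simp add: v_def)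
    show "(\<Sum>m<N. v i m * v j m) = k i j" if "i < N" for i j N
      using expand[where N = N and i = i and j = j] zero[OF that] by simp
    show "v n n \<ge> 0" for n using rpos by (simp add: v_def)
    show "v i n = 0" if "v n n = 0" for i n using that by (auto simp: v_def)
  qed
qed

text \<open>
  Each unit vector in a used coordinate is a combination of $v_0, \dots, v_n$, by forward
  substitution. The rows $b_n$ for unused coordinates are combinations that vanish.
\<close>

lemma triangular_dual:
  fixes v :: "nat \<Rightarrow> nat \<Rightarrow> real"
  assumes tri: "\<And>i n. i < n \<Longrightarrow> v i n = 0" and deg: "\<And>i n. v n n = 0 \<Longrightarrow> v i n = 0"
  obtains b :: "nat \<Rightarrow> nat \<Rightarrow> real" where
    "\<And>n i. n < i \<Longrightarrow> b n i = 0"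
    "\<And>n N m. n < N \<Longrightarrow> (\<Sum>i<N. b n i * v i m) = (if m = n \<and> v n n \<noteq> 0 then 1 else 0)"
proof -
  let ?P = "\<lambda>n b. (\<forall>i>n. b i = 0) \<and>
    (\<forall>N>n. \<forall>m. (\<Sum>i<N. b i * v i m) = (if m = n \<and> v n n \<noteq> 0 then 1 else 0))"
  have "\<exists>b. ?P n b" for n
  proof (induction n rule: less_induct)
    case (less n)
    show ?case
    proof (cases "v n n = 0")
      case True
      then show ?thesis by (intro exI[of _ "\<lambda>_. 0"]) simp
    next
      case False
      have "\<forall>m\<in>{..<n}. \<exists>b. ?P m b" using less by simp
      from bchoice[OF this] obtain B where B': "\<forall>m\<in>{..<n}. ?P m (B m)" ..
      have B: "?P m (B m)" if "m < n" for m using bspec[OF B', of m] that by simp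
      define b where "b i = ((if i = n then 1 else 0) - (\<Sum>m<n. v n m * B m i)) / v n n" for i
      have b_scaled: "b i * v n n = (if i = n then 1 else 0) - (\<Sum>m<n. v n m * B m i)" for i
        using False by (simp add: b_def)
      have "(\<Sum>i<N. b i * v i l) = (if l = n \<and> v n n \<noteq> 0 then 1 else 0)" if "N > n" for N l
      proof -
        have "(\<Sum>i<N. b i * v i l) * v n n =
            (\<Sum>i<N. (if i = n then v i l else 0) - (\<Sum>m<n. v n m * (B m i * v i l)))"
          unfolding sum_distrib_right mult.assoc mult.commute[of "v _ l" "v n n"]
          unfolding mult.assoc[symmetric] b_scaled
          by (intro sum.cong) (auto simp: left_diff_distrib sum_distrib_right mult.assoc)
        also have "\<dots> = v n l - (\<Sum>m<n. v n m * (\<Sum>i<N. B m i * v i l))"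
          using that by (simp add: sum_subtractf sum_distrib_left) (rule sum.swap)
        also have "(\<Sum>m<n. v n m * (\<Sum>i<N. B m i * v i l)) = (\<Sum>m<n. if m = l then v n m else 0)"
        proof (intro sum.cong refl)
          fix m assume "m \<in> {..<n}"
          then have "(\<Sum>i<N. B m i * v i l) = (if l = m \<and> v m m \<noteq> 0 then 1 else 0)"
            using B[of m] that by auto
          then show "v n m * (\<Sum>i<N. B m i * v i l) = (if m = l then v n m else 0)"
            using deg by auto
        qed
        also have "v n l - \<dots> = (if l = n then v n n else 0)"
          using tri[of n l] by (auto simp: not_less)
        finally show ?thesis using False by (auto split: if_splits)
      qed
      moreover have "b i = 0" if "i > n" for i
        using that B by (auto simp: b_def intro!: sum.neutral)
      ultimately show ?thesis by blast
    qed
  qed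
  then have "\<forall>n. \<exists>b. ?P n b" ..
  from choice[OF this] obtain b where b: "\<forall>n. ?P n (b n)" ..
  show ?thesis by (rule that[of b]) (use b in auto)
qed

section \<open>Normal matrices from positive kernels\<close>

text \<open>
  The operators below are real matrices with finitely supported rows and columns. All entries of
  their products are finite sums, and no convergence question arises for them.
\<close>

definition finite_rows :: "(nat \<Rightarrow> nat \<Rightarrow> real) \<Rightarrow> bool"
  where "finite_rows G \<longleftrightarrow> (\<forall>n. \<exists>M. \<forall>m\<ge>M. G n m = 0)"

text \<open>
  The bilinear form of the matrix is bounded by one on finitely supported vectors. In this shape
  the condition is visibly invariant under transposition.
\<close>

definition contraction_matrix :: "(nat \<Rightarrow> nat \<Rightarrow> real) \<Rightarrow> bool"
  where "contraction_matrix G \<longleftrightarrow>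
    (\<forall>N M x y. (\<Sum>n<N. \<Sum>m<M. y n * G n m * x m)\<^sup>2 \<le> (\<Sum>n<N. (y n)\<^sup>2) * (\<Sum>m<M. (x m)\<^sup>2))"

text \<open>
  The entries of $G G^T$ and $G^T G$ agree; long partial sums express the infinite sums because
  rows and columns have finite support.
\<close>

definition normal_matrix :: "(nat \<Rightarrow> nat \<Rightarrow> real) \<Rightarrow> bool"
  where "normal_matrix G \<longleftrightarrow>
    (\<forall>n l. \<exists>L0. \<forall>L\<ge>L0. (\<Sum>m<L. G n m * G l m) = (\<Sum>m<L. G m n * G m l))"

text \<open>
  In a triangular factorization, such a vector $v_p$ is a positive multiple of the unit vector at
  $p$.
\<close>

definition orthogonal_to_earlier :: "(nat \<Rightarrow> nat \<Rightarrow> real) \<Rightarrow> nat \<Rightarrow> bool"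
  where "orthogonal_to_earlier k p \<longleftrightarrow> k p p > 0 \<and> (\<forall>j<p. k p j = 0)"

lemma gram_expand:
  fixes w :: "nat \<Rightarrow> nat \<Rightarrow> real"
  shows "(\<Sum>m<M. (\<Sum>i<N. c i * w i m) * (\<Sum>j<N. d j * w j m)) =
    (\<Sum>i<N. \<Sum>j<N. c i * d j * (\<Sum>m<M. w i m * w j m))"
proof -
  have "(\<Sum>m<M. (\<Sum>i<N. c i * w i m) * (\<Sum>j<N. d j * w j m)) =
      (\<Sum>m<M. \<Sum>i<N. \<Sum>j<N. c i * d j * (w i m * w j m))"
    by (simp add: sum_product mult_ac)
  also have "\<dots> = (\<Sum>i<N. \<Sum>j<N. \<Sum>m<M. c i * d j * (w i m * w j m))"
    by (subst sum.swap, subst (2) sum.swap) simp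
  finally show ?thesis by (simp add: sum_distrib_left)
qed

text \<open>
  Let $v_i$ be vectors with Gram matrix $k$. The index map $\sigma$ induces a contraction
  $v_i \mapsto v_{\sigma i}$ on their span, since the quadratic form of $k$ decreases under
  $\sigma$; by the compatibility of $\sigma$ and $\tau$ with $k$, its adjoint is
  $v_i \mapsto v_{\tau i}$, and it is normal. The matrix $G$ has as its $n$-th row the image of the
  $n$-th unit vector, so as an operator on columns it is the adjoint of the map induced by
  $\sigma$, that is, $v_i \mapsto v_{\tau i}$. For the kernel of a rotation invariant measure,
  $\tau$ will be multiplication by $z$ and $\sigma$ multiplication by $\bar z$. The last property
  describes the columns of $G$ at the places where $v_p$ is a multiple of a unit vector.
\<close>

lemma kernel_shift_matrix:
  fixes k :: "nat \<Rightarrow> nat \<Rightarrow> real" and \<sigma> \<tau> :: "nat \<Rightarrow> nat"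
  assumes pos: "positive_kernel k" and sym: "symmetric_kernel k"
    and contr: "positive_kernel (\<lambda>i j. k i j - k (\<sigma> i) (\<sigma> j))"
    and adj: "\<And>i j. k (\<sigma> i) j = k i (\<tau> j)"
    and comm: "\<And>i j. k (\<sigma> i) (\<sigma> j) = k (\<tau> i) (\<tau> j)"
  obtains G where
    "finite_rows G" "finite_rows (\<lambda>m n. G n m)" "contraction_matrix G" "normal_matrix G"
    "\<And>p l. \<lbrakk>orthogonal_to_earlier k p; orthogonal_to_earlier k (\<tau> p)\<rbrakk>
      \<Longrightarrow> G l p = (if l = \<tau> p then sqrt (k (\<tau> p) (\<tau> p) / k p p) else 0)"
proof -
  obtain v where tri: "\<And>i n. i < n \<Longrightarrow> v i n = 0"
    and gram: "\<And>i j N. i < N \<Longrightarrow> (\<Sum>m<N. v i m * v j m) = k i j"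
    and deg: "\<And>i n. v n n = 0 \<Longrightarrow> v i n = (0::real)"
    and diag: "\<And>n. v n n \<ge> 0"
    by (rule triangular_factorization[OF pos sym]) (rule that)
  obtain b where bz: "\<And>n i. n < i \<Longrightarrow> b n i = 0"
    and dual: "\<And>n N m. n < N \<Longrightarrow> (\<Sum>i<N. b n i * v i m) = (if m = n \<and> v n n \<noteq> 0 then 1 else 0)"
    by (rule triangular_dual[of v]) (erule tri, erule deg, rule that)
  have ksym: "k i j = k j i" for i j using sym by (simp add: symmetric_kernel_def)
  \<comment> \<open>Coordinates are inner products with the dual combinations. In an unused coordinate both
    sides vanish.\<close>
  have coord: "v j m = (\<Sum>i<N. b m i * k j i)" if "m < N" for j m N
  proof -
    define L where "L = Suc (max j m)"
    have L: "j < L" "m < L" by (auto simp: L_def)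
    have "(\<Sum>i<N. b m i * k j i) = (\<Sum>i<N. b m i * (\<Sum>l<L. v j l * v i l))"
      by (simp only: gram[OF L(1)])
    also have "\<dots> = (\<Sum>l<L. v j l * (\<Sum>i<N. b m i * v i l))"
      by (simp add: sum_distrib_left mult_ac) (rule sum.swap)
    also have "\<dots> = (\<Sum>l<L. if l = m then v j l else 0)"
      by (intro sum.cong) (auto simp: dual[OF that] deg)
    also have "\<dots> = v j m" using L(2) by simp
    finally show ?thesis ..
  qed
  define g where "g s n m = (\<Sum>i\<le>n. b n i * v (s i) m)" for s :: "nat \<Rightarrow> nat" and n m
  have g_sum: "g s n m = (\<Sum>i<N. b n i * v (s i) m)" if "n < N" for s n m N
    unfolding g_def by (rule sum.mono_neutral_left) (use that bz in auto)
  have g_kernel: "g s n m = (\<Sum>i<N. \<Sum>j<N. b n i * b m j * k (s i) j)" if "n < N" "m < N" for s n m N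
    by (simp add: g_sum[OF that(1)] coord[OF that(2)] sum_distrib_left mult_ac)
  \<comment> \<open>The columns have finite support because they are the rows of the matrix for \<open>\<tau>\<close>.\<close>
  have transpose: "g \<sigma> n m = g \<tau> m n" for n m
  proof -
    define N where "N = Suc (max n m)"
    have N: "n < N" "m < N" by (auto simp: N_def)
    have "g \<sigma> n m = (\<Sum>i<N. \<Sum>j<N. b n i * b m j * k (\<tau> j) i)"
      by (simp add: g_kernel[OF N] adj ksym[of "\<tau> _"])
    also have "\<dots> = g \<tau> m n"
      by (subst sum.swap) (simp add: g_kernel[OF N(2,1)] mult_ac)
    finally show ?thesis .
  qed
  have rows: "finite_rows (g s)" for s
    unfolding finite_rows_def
  proof
    fix n
    obtain M where M: "\<And>i. i \<le> n \<Longrightarrow> s i < M"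
      using finite_nat_set_iff_bounded[of "s ` {..n}"] by auto
    have "g s n m = 0" if "m \<ge> M" for m
      unfolding g_def by (intro sum.neutral) (use M tri that in \<open>auto intro: less_le_trans\<close>)
    then show "\<exists>M. \<forall>m\<ge>M. g s n m = 0" by blast
  qed
  \<comment> \<open>Inner products of combinations of rows are expressed by the kernel. They have to be compared
    with a kernel at shifted indices, both for contractivity and for normality.\<close>
  have gram_rows: "\<exists>L0. \<forall>L\<ge>L0. (\<Sum>m<L. (\<Sum>n<N. y n * g s n m) * (\<Sum>n<N. z n * g s n m)) =
      (\<Sum>i<N. \<Sum>j<N. (\<Sum>n<N. y n * b n i) * (\<Sum>n<N. z n * b n j) * k (s i) (s j))" for s y z N
  proof -
    obtain L0 where L0: "\<And>i. i < N \<Longrightarrow> s i < L0"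
      using finite_nat_set_iff_bounded[of "s ` {..<N}"] by auto
    have row: "(\<Sum>n<N. y n * g s n m) = (\<Sum>i<N. (\<Sum>n<N. y n * b n i) * v (s i) m)" for y m
    proof -
      have "(\<Sum>n<N. y n * g s n m) = (\<Sum>n<N. \<Sum>i<N. y n * b n i * v (s i) m)"
        by (intro sum.cong) (auto simp: g_sum[of _ N] sum_distrib_left mult_ac)
      then show ?thesis by (subst (asm) sum.swap) (simp add: sum_distrib_right)
    qed
    have "(\<Sum>m<L. (\<Sum>n<N. y n * g s n m) * (\<Sum>n<N. z n * g s n m)) =
      (\<Sum>i<N. \<Sum>j<N. (\<Sum>n<N. y n * b n i) * (\<Sum>n<N. z n * b n j) * k (s i) (s j))" if "L \<ge> L0" for L
    proof -
      let ?c = "\<lambda>y i. \<Sum>n<N. y n * b n i"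
      have "(\<Sum>m<L. (\<Sum>n<N. y n * g s n m) * (\<Sum>n<N. z n * g s n m)) =
        (\<Sum>i<N. \<Sum>j<N. ?c y i * ?c z j * (\<Sum>m<L. v (s i) m * v (s j) m))"
        unfolding row by (rule gram_expand)
      also have "\<dots> = (\<Sum>i<N. \<Sum>j<N. ?c y i * ?c z j * k (s i) (s j))"
      proof (intro sum.cong refl)
        fix i j assume "i \<in> {..<N}"
        then have "s i < L" using L0[of i] that by simp
        then show "?c y i * ?c z j * (\<Sum>m<L. v (s i) m * v (s j) m) = ?c y i * ?c z j * k (s i) (s j)"
          by (simp only: gram)
      qed
      finally show ?thesis .
    qed
    then show ?thesis by blast
  qed
  \<comment> \<open>The dual combinations are orthonormal except for null vectors, so the form of \<open>k\<close> at the
    combination with coefficients \<open>y\<close> is at most the squared norm of \<open>y\<close>.\<close>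
  have norm: "(\<Sum>m<M. (\<Sum>n<N. y n * g \<sigma> n m)\<^sup>2) \<le> (\<Sum>n<N. (y n)\<^sup>2)" for y N M
  proof -
    let ?c = "\<lambda>i. \<Sum>n<N. y n * b n i"
    obtain L0 where L0: "\<And>L. L \<ge> L0 \<Longrightarrow> (\<Sum>m<L. (\<Sum>n<N. y n * g \<sigma> n m) * (\<Sum>n<N. y n * g \<sigma> n m)) =
      (\<Sum>i<N. \<Sum>j<N. ?c i * ?c j * k (\<sigma> i) (\<sigma> j))" using gram_rows[where N = N and y = y and s = \<sigma> and z = y] by blast
    have "(\<Sum>m<M. (\<Sum>n<N. y n * g \<sigma> n m)\<^sup>2) \<le> (\<Sum>m<max L0 M. (\<Sum>n<N. y n * g \<sigma> n m)\<^sup>2)"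
      by (rule sum_mono2) auto
    also have "\<dots> = (\<Sum>i<N. \<Sum>j<N. ?c i * ?c j * k (\<sigma> i) (\<sigma> j))"
      using L0[of "max L0 M"] by (simp add: power2_eq_square)
    also have "\<dots> \<le> (\<Sum>i<N. \<Sum>j<N. ?c i * ?c j * k i j)"
    proof -
      have "0 \<le> (\<Sum>i<N. \<Sum>j<N. ?c i * ?c j * (k i j - k (\<sigma> i) (\<sigma> j)))"
        by (rule positive_kernelD[OF contr]) simp
      then show ?thesis by (simp add: right_diff_distrib sum_subtractf)
    qed
    also have "\<dots> = (\<Sum>i<N. \<Sum>j<N. ?c i * ?c j * (\<Sum>m<N. v i m * v j m))"
      by (intro sum.cong refl) (simp add: gram)
    also have "\<dots> = (\<Sum>m<N. (\<Sum>i<N. ?c i * v i m)\<^sup>2)"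
      unfolding power2_eq_square by (rule gram_expand[symmetric])
    also have "\<dots> \<le> (\<Sum>m<N. (y m)\<^sup>2)"
    proof (rule sum_mono)
      fix m assume m: "m \<in> {..<N}"
      have "(\<Sum>i<N. ?c i * v i m) = (\<Sum>n<N. y n * (\<Sum>i<N. b n i * v i m))"
        unfolding sum_distrib_right sum_distrib_left by (subst sum.swap) (simp add: mult_ac)
      also have "\<dots> = (\<Sum>n<N. if n = m then (if v m m \<noteq> 0 then y m else 0) else 0)"
        by (intro sum.cong) (auto simp: dual)
      also have "\<dots> = (if v m m \<noteq> 0 then y m else 0)" using m by simp
      finally show "(\<Sum>i<N. ?c i * v i m)\<^sup>2 \<le> (y m)\<^sup>2" by simp
    qed
    finally show ?thesis .
  qed
  show ?thesis
  proof (rule that[of "g \<sigma>"])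
    show "finite_rows (g \<sigma>)" by (rule rows)
    show "finite_rows (\<lambda>m n. g \<sigma> n m)" using rows[of \<tau>] by (simp add: transpose)
    show "contraction_matrix (g \<sigma>)"
      unfolding contraction_matrix_def
    proof (intro allI)
      fix N M x y
      have "(\<Sum>n<N. \<Sum>m<M. y n * g \<sigma> n m * x m) = (\<Sum>m<M. (\<Sum>n<N. y n * g \<sigma> n m) * x m)"
        by (subst sum.swap) (simp add: sum_distrib_right)
      then have "(\<Sum>n<N. \<Sum>m<M. y n * g \<sigma> n m * x m)\<^sup>2 \<le>
          (\<Sum>m<M. (\<Sum>n<N. y n * g \<sigma> n m)\<^sup>2) * (\<Sum>m<M. (x m)\<^sup>2)"
        using Cauchy_Schwarz_ineq_sum[of "\<lambda>m. \<Sum>n<N. y n * g \<sigma> n m" x "{..<M}"] by simp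
      also have "\<dots> \<le> (\<Sum>n<N. (y n)\<^sup>2) * (\<Sum>m<M. (x m)\<^sup>2)"
        by (intro mult_right_mono norm sum_nonneg) auto
      finally show "(\<Sum>n<N. \<Sum>m<M. y n * g \<sigma> n m * x m)\<^sup>2 \<le> (\<Sum>n<N. (y n)\<^sup>2) * (\<Sum>m<M. (x m)\<^sup>2)" .
    qed
    show "normal_matrix (g \<sigma>)"
      unfolding normal_matrix_def
    proof (intro allI)
      fix n l
      define N where "N = Suc (max n l)"
      have pick: "(\<Sum>i<N. (if i = n then 1 else 0) * f i) = f n"
        "(\<Sum>i<N. (if i = l then 1 else 0) * f i) = f l" for f :: "nat \<Rightarrow> real"
        by (simp_all add: N_def if_distrib[of "\<lambda>x. x * _"] cong: if_cong)
      obtain L1 where L1: "\<And>L. L \<ge> L1 \<Longrightarrow> (\<Sum>m<L. g \<sigma> n m * g \<sigma> l m) =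
          (\<Sum>i<N. \<Sum>j<N. b n i * b l j * k (\<sigma> i) (\<sigma> j))"
        using gram_rows[where N = N and y = "\<lambda>i. if i = n then 1 else 0" and s = \<sigma>
            and z = "\<lambda>i. if i = l then 1 else 0"]
        unfolding pick by blast
      obtain L2 where L2: "\<And>L. L \<ge> L2 \<Longrightarrow> (\<Sum>m<L. g \<tau> n m * g \<tau> l m) =
          (\<Sum>i<N. \<Sum>j<N. b n i * b l j * k (\<tau> i) (\<tau> j))"
        using gram_rows[where N = N and y = "\<lambda>i. if i = n then 1 else 0" and s = \<tau>
            and z = "\<lambda>i. if i = l then 1 else 0"]
        unfolding pick by blast
      show "\<exists>L0. \<forall>L\<ge>L0. (\<Sum>m<L. g \<sigma> n m * g \<sigma> l m) = (\<Sum>m<L. g \<sigma> m n * g \<sigma> m l)"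
      proof (intro exI[of _ "max L1 L2"] allI impI)
        fix L assume "max L1 L2 \<le> L"
        then have L: "L1 \<le> L" "L2 \<le> L" by auto
        have "(\<Sum>m<L. g \<sigma> m n * g \<sigma> m l) = (\<Sum>m<L. g \<tau> n m * g \<tau> l m)"
          by (simp only: transpose)
        then show "(\<Sum>m<L. g \<sigma> n m * g \<sigma> l m) = (\<Sum>m<L. g \<sigma> m n * g \<sigma> m l)"
          by (simp only: L1[OF L(1)] L2[OF L(2)] comm)
      qed
    qed
    show "g \<sigma> l p = (if l = \<tau> p then sqrt (k (\<tau> p) (\<tau> p) / k p p) else 0)"
      if p: "orthogonal_to_earlier k p" and q: "orthogonal_to_earlier k (\<tau> p)" for p l
    proof -
      have basis: "v r r = sqrt (k r r)" "\<And>i. v i r * v r r = k i r"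
        if r: "orthogonal_to_earlier k r" for r
      proof -
        have below: "v r m = 0" if "m < r" for m
          using coord[of m r r] r that by (simp add: orthogonal_to_earlier_def)
        have *: "k i r = v i r * v r r" for i
        proof -
          have "k i r = (\<Sum>m<Suc r. v r m * v i m)"
            by (subst ksym) (simp only: gram[of r "Suc r" i] lessI)
          then show ?thesis using below by simp
        qed
        then show "v i r * v r r = k i r" for i by simp
        show "v r r = sqrt (k r r)" using diag[of r] by (simp add: *)
      qed
      have vpp: "v p p > 0" and vqq: "v (\<tau> p) (\<tau> p) > 0"
        using basis(1)[OF p] basis(1)[OF q] p q by (simp_all add: orthogonal_to_earlier_def)
      have "v (\<sigma> i) p = v i (\<tau> p) * (v (\<tau> p) (\<tau> p) / v p p)" for i
        using basis(2)[OF p, of "\<sigma> i"] basis(2)[OF q, of i] adj[of i p] vpp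
        by (simp add: field_simps)
      then have "g \<sigma> l p = (\<Sum>i<Suc l. b l i * v i (\<tau> p)) * (v (\<tau> p) (\<tau> p) / v p p)"
        by (simp only: g_sum[of l "Suc l"] lessI sum_distrib_right mult.assoc)
      also have "(\<Sum>i<Suc l. b l i * v i (\<tau> p)) = (if l = \<tau> p then 1 else 0)"
        using vqq by (subst dual) auto
      also have "v (\<tau> p) (\<tau> p) / v p p = sqrt (k (\<tau> p) (\<tau> p) / k p p)"
        by (simp add: basis(1)[OF p] basis(1)[OF q] real_sqrt_divide)
      finally show ?thesis by simp
    qed
  qed
qed

section \<open>Square-summable sequences\<close>

definition l2_set :: "(nat \<Rightarrow> complex) set"
  where "l2_set = {x. summable (\<lambda>n. (cmod (x n))\<^sup>2)}"

definition l2_norm :: "(nat \<Rightarrow> complex) \<Rightarrow> real"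
  where "l2_norm x = sqrt (\<Sum>n. (cmod (x n))\<^sup>2)"

lemma l2_norm_nonneg: "x \<in> l2_set \<Longrightarrow> l2_norm x \<ge> 0"
  unfolding l2_norm_def by (simp add: l2_set_def suminf_nonneg)

text \<open>
  Bounds on the finite sections suffice for membership and for the norm, so that the inequalities
  of Minkowski and Cauchy--Schwarz for finite sums carry over.
\<close>

lemma l2_I:
  assumes "\<And>N. L2_set (\<lambda>n. cmod (x n)) {..<N} \<le> C"
  shows "x \<in> l2_set" and "l2_norm x \<le> C"
proof -
  have C: "0 \<le> C" using assms[of 0] by simp
  have le: "(\<Sum>n<N. (cmod (x n))\<^sup>2) \<le> C\<^sup>2" for N
    using power_mono[OF assms[of N] L2_set_nonneg, of 2] by (simp add: L2_set_def sum_nonneg)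
  show x: "x \<in> l2_set"
    using summableI_nonneg_bounded[OF _ le] by (simp add: l2_set_def)
  have "(\<Sum>n. (cmod (x n))\<^sup>2) \<le> C\<^sup>2"
    by (rule suminf_le_const) (use x le in \<open>auto simp: l2_set_def\<close>)
  then show "l2_norm x \<le> C"
    unfolding l2_norm_def using C by (rule real_le_lsqrt[rotated -1]) 
qed

lemma l2_section_le:
  assumes "x \<in> l2_set"
  shows "L2_set (\<lambda>n. cmod (x n)) {..<N} \<le> l2_norm x"
  unfolding l2_norm_def L2_set_def
  by (intro real_sqrt_le_mono sum_le_suminf) (use assms in \<open>auto simp: l2_set_def\<close>)

lemma l2_coordinate_le:
  assumes "x \<in> l2_set"
  shows "cmod (x n) \<le> l2_norm x"
  using member_le_L2_set[of "{..<Suc n}" n "\<lambda>n. cmod (x n)"] l2_section_le[OF assms, of "Suc n"]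
  by simp

lemma l2_add:
  assumes "x \<in> l2_set" "y \<in> l2_set"
  shows "(\<lambda>n. x n + y n) \<in> l2_set" and "l2_norm (\<lambda>n. x n + y n) \<le> l2_norm x + l2_norm y"
proof -
  have "L2_set (\<lambda>n. cmod (x n + y n)) {..<N} \<le> l2_norm x + l2_norm y" for N
  proof -
    have "L2_set (\<lambda>n. cmod (x n + y n)) {..<N} \<le> L2_set (\<lambda>n. cmod (x n) + cmod (y n)) {..<N}"
      by (intro L2_set_mono norm_triangle_ineq) auto
    also have "\<dots> \<le> L2_set (\<lambda>n. cmod (x n)) {..<N} + L2_set (\<lambda>n. cmod (y n)) {..<N}"
      by (rule L2_set_triangle_ineq)
    also have "\<dots> \<le> l2_norm x + l2_norm y"
      by (intro add_mono l2_section_le assms)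
    finally show ?thesis .
  qed
  from l2_I[OF this] show "(\<lambda>n. x n + y n) \<in> l2_set" "l2_norm (\<lambda>n. x n + y n) \<le> l2_norm x + l2_norm y" .
qed

lemma l2_zero [simp]: "(\<lambda>n. 0) \<in> l2_set"
  by (simp add: l2_set_def)

lemma l2_scale [simp]: "x \<in> l2_set \<Longrightarrow> (\<lambda>n. c * x n) \<in> l2_set"
  using summable_mult[of "\<lambda>n. (cmod (x n))\<^sup>2" "(cmod c)\<^sup>2"] by (simp add: l2_set_def norm_mult power_mult_distrib)

lemma l2_uminus [simp]: "x \<in> l2_set \<Longrightarrow> (\<lambda>n. - x n) \<in> l2_set"
  by (simp add: l2_set_def)

declare l2_add(1) [simp]

lemma l2_norm_minus_commute: "l2_norm (\<lambda>n. x n - y n) = l2_norm (\<lambda>n. y n - x n)"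
  unfolding l2_norm_def by (simp add: norm_minus_commute)

lemma l2_diff [simp]: "x \<in> l2_set \<Longrightarrow> y \<in> l2_set \<Longrightarrow> (\<lambda>n. x n - y n) \<in> l2_set"
  using l2_add(1)[of x "\<lambda>n. - y n"] by simp

lemma l2_norm_eq_0: "x \<in> l2_set \<Longrightarrow> l2_norm x = 0 \<Longrightarrow> x n = 0"
  using l2_coordinate_le[of x n] by simp

lemma l2_inner_summable:
  assumes "x \<in> l2_set" "y \<in> l2_set"
  shows "summable (\<lambda>n. cmod (x n * cnj (y n)))" and "summable (\<lambda>n. x n * cnj (y n))"
    and "cmod (\<Sum>n. x n * cnj (y n)) \<le> l2_norm x * l2_norm y"
proof -
  have le: "(\<Sum>n<N. cmod (x n * cnj (y n))) \<le> l2_norm x * l2_norm y" for N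
  proof -
    have "(\<Sum>n<N. cmod (x n * cnj (y n))) \<le> L2_set (\<lambda>n. cmod (x n)) {..<N} * L2_set (\<lambda>n. cmod (y n)) {..<N}"
      using L2_set_mult_ineq[of "\<lambda>n. cmod (x n)" "\<lambda>n. cmod (y n)" "{..<N}"] by (simp add: norm_mult)
    also have "\<dots> \<le> l2_norm x * l2_norm y"
      by (intro mult_mono l2_section_le assms l2_norm_nonneg L2_set_nonneg)
    finally show ?thesis .
  qed
  show s: "summable (\<lambda>n. cmod (x n * cnj (y n)))"
    by (rule summableI_nonneg_bounded[OF _ le]) simp
  then show "summable (\<lambda>n. x n * cnj (y n))" by (rule summable_norm_cancel)
  have "cmod (\<Sum>n. x n * cnj (y n)) \<le> (\<Sum>n. cmod (x n * cnj (y n)))"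
    by (rule summable_norm[OF s])
  also have "\<dots> \<le> l2_norm x * l2_norm y"
    by (rule suminf_le_const[OF s le])
  finally show "cmod (\<Sum>n. x n * cnj (y n)) \<le> l2_norm x * l2_norm y" .
qed

text \<open>
  A Cauchy sequence converges in each coordinate. The Cauchy estimate for finite sections passes to
  the coordinatewise limit, with a bound that does not depend on the section.
\<close>

lemma l2_complete:
  fixes x :: "nat \<Rightarrow> nat \<Rightarrow> complex"
  assumes x: "\<And>k. x k \<in> l2_set"
    and cauchy: "\<And>e. e > 0 \<Longrightarrow> \<exists>K. \<forall>k\<ge>K. \<forall>l\<ge>K. l2_norm (\<lambda>n. x k n - x l n) < e"
  obtains y where "y \<in> l2_set" "\<And>e. e > 0 \<Longrightarrow> \<exists>K. \<forall>k\<ge>K. l2_norm (\<lambda>n. x k n - y n) < e"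
proof -
  have "convergent (\<lambda>k. x k n)" for n
  proof (rule Cauchy_convergent, rule metric_CauchyI)
    fix e :: real assume "e > 0"
    then obtain K where K: "\<And>k l. k \<ge> K \<Longrightarrow> l \<ge> K \<Longrightarrow> l2_norm (\<lambda>n. x k n - x l n) < e"
      using cauchy by blast
    show "\<exists>M. \<forall>m\<ge>M. \<forall>k\<ge>M. dist (x m n) (x k n) < e"
      using K l2_coordinate_le[OF l2_diff[OF x x]] unfolding dist_norm by (meson le_less_trans)
  qed
  then have "\<forall>n. \<exists>z. (\<lambda>k. x k n) \<longlonglongrightarrow> z" by (auto simp: convergent_def)
  from choice[OF this] obtain y where y: "\<And>n. (\<lambda>k. x k n) \<longlonglongrightarrow> y n" by auto
  have close: "\<exists>K. \<forall>k\<ge>K. (\<lambda>n. x k n - y n) \<in> l2_set \<and> l2_norm (\<lambda>n. x k n - y n) \<le> e" if e: "e > 0" for e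
  proof -
    obtain K where K: "\<And>k l. k \<ge> K \<Longrightarrow> l \<ge> K \<Longrightarrow> l2_norm (\<lambda>n. x k n - x l n) < e"
      using cauchy[OF e] by blast
    have "L2_set (\<lambda>n. cmod (x k n - y n)) {..<N} \<le> e" if k: "k \<ge> K" for k N
    proof (rule tendsto_upperbound)
      show "(\<lambda>l. L2_set (\<lambda>n. cmod (x k n - x l n)) {..<N}) \<longlonglongrightarrow> L2_set (\<lambda>n. cmod (x k n - y n)) {..<N}"
        unfolding L2_set_def by (intro tendsto_intros y)
      have "L2_set (\<lambda>n. cmod (x k n - x l n)) {..<N} \<le> e" if "l \<ge> K" for l
        using l2_section_le[OF l2_diff[OF x x], of k l N] K[OF k that] by linarith
      then show "\<forall>\<^sub>F l in sequentially. L2_set (\<lambda>n. cmod (x k n - x l n)) {..<N} \<le> e"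
        unfolding eventually_sequentially by blast
    qed simp
    from l2_I[OF this] show ?thesis by blast
  qed
  show ?thesis
  proof (rule that[of y])
    obtain K where "(\<lambda>n. x K n - y n) \<in> l2_set" using close[of 1] by auto
    from l2_diff[OF x this, of K] show "y \<in> l2_set" by simp
    show "\<exists>K. \<forall>k\<ge>K. l2_norm (\<lambda>n. x k n - y n) < e" if e: "e > 0" for e
    proof -
      obtain K where "\<forall>k\<ge>K. l2_norm (\<lambda>n. x k n - y n) \<le> e / 2"
        using close[of "e / 2"] e by auto
      then show ?thesis using e by (intro exI[of _ K]) fastforce
    qed
  qed
qed

section \<open>Matrices acting on square-summable sequences\<close>

definition matrix_apply :: "(nat \<Rightarrow> nat \<Rightarrow> real) \<Rightarrow> (nat \<Rightarrow> complex) \<Rightarrow> nat \<Rightarrow> complex"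
  where "matrix_apply G x n = (\<Sum>m | G n m \<noteq> 0. of_real (G n m) * x m)"

lemma matrix_apply_eq:
  assumes "\<And>m. m \<ge> M \<Longrightarrow> G n m = 0"
  shows "matrix_apply G x n = (\<Sum>m<M. of_real (G n m) * x m)"
  unfolding matrix_apply_def by (rule sum.mono_neutral_left) (use assms in \<open>auto simp: not_less[symmetric]\<close>)

lemma finite_rows_bound:
  assumes "finite_rows G"
  obtains M where "\<And>n m. n < N \<Longrightarrow> m \<ge> M \<Longrightarrow> G n m = 0" "M \<ge> K"
proof -
  have "\<forall>n. \<exists>M. \<forall>m\<ge>M. G n m = 0" using assms by (simp add: finite_rows_def)
  from choice[OF this] obtain B where B: "\<And>n m. m \<ge> B n \<Longrightarrow> G n m = 0" by auto
  obtain C where C: "\<And>n. n < N \<Longrightarrow> B n < C"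
    using finite_nat_set_iff_bounded[of "B ` {..<N}"] by auto
  show ?thesis
  proof (rule that[of "max C K"])
    show "G n m = 0" if "n < N" "m \<ge> max C K" for n m
      using C[OF that(1)] that(2) by (intro B) simp
  qed simp
qed

lemma contraction_matrixD:
  "contraction_matrix G \<Longrightarrow>
    (\<Sum>n<N. \<Sum>m<M. y n * G n m * x m)\<^sup>2 \<le> (\<Sum>n<N. (y n)\<^sup>2) * (\<Sum>m<M. (x m)\<^sup>2)"
  by (simp add: contraction_matrix_def)

text \<open>
  Testing the bilinear form against $y = Gx$ gives $\|Gx\|^4 \le \|Gx\|^2 \|x\|^2$.
\<close>

lemma contraction_matrix_section:
  assumes "contraction_matrix G"
  shows "(\<Sum>n<N. (\<Sum>m<M. G n m * x m)\<^sup>2) \<le> (\<Sum>m<M. (x m)\<^sup>2)"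
proof -
  let ?S = "\<Sum>n<N. (\<Sum>m<M. G n m * x m)\<^sup>2"
  have S: "?S = (\<Sum>n<N. \<Sum>m<M. (\<Sum>m<M. G n m * x m) * G n m * x m)"
    by (simp add: power2_eq_square sum_distrib_left mult_ac)
  then have "?S\<^sup>2 \<le> ?S * (\<Sum>m<M. (x m)\<^sup>2)"
    using contraction_matrixD[OF assms, where N = N and M = M and y = "\<lambda>n. \<Sum>m<M. G n m * x m" and x = x] by (simp only: S[symmetric])
  then have "?S * ?S \<le> ?S * (\<Sum>m<M. (x m)\<^sup>2)" by (simp add: power2_eq_square)
  moreover have "?S \<ge> 0" by (intro sum_nonneg) auto
  ultimately show ?thesis
    by (cases "?S = 0") (auto simp: sum_nonneg)
qed

text \<open>
  The matrix is real, so it acts separately on real and imaginary parts.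
\<close>

lemma matrix_apply_l2:
  assumes G: "finite_rows G" "contraction_matrix G" and x: "x \<in> l2_set"
  shows "matrix_apply G x \<in> l2_set" and "l2_norm (matrix_apply G x) \<le> l2_norm x"
proof -
  have "L2_set (\<lambda>n. cmod (matrix_apply G x n)) {..<N} \<le> l2_norm x" for N
  proof -
    obtain M where M: "\<And>n m. n < N \<Longrightarrow> m \<ge> M \<Longrightarrow> G n m = 0"
      using finite_rows_bound[OF G(1)] by metis
    have "(\<Sum>n<N. (cmod (matrix_apply G x n))\<^sup>2) =
       (\<Sum>n<N. (\<Sum>m<M. G n m * Re (x m))\<^sup>2) + (\<Sum>n<N. (\<Sum>m<M. G n m * Im (x m))\<^sup>2)"
      unfolding sum.distrib[symmetric]
      by (intro sum.cong refl) (simp add: matrix_apply_eq[OF M] cmod_power2)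
    also have "\<dots> \<le> (\<Sum>m<M. (Re (x m))\<^sup>2) + (\<Sum>m<M. (Im (x m))\<^sup>2)"
      by (intro add_mono contraction_matrix_section G)
    also have "\<dots> = (\<Sum>m<M. (cmod (x m))\<^sup>2)"
      by (simp add: cmod_power2 sum.distrib)
    finally have "L2_set (\<lambda>n. cmod (matrix_apply G x n)) {..<N} \<le> L2_set (\<lambda>m. cmod (x m)) {..<M}"
      unfolding L2_set_def by (rule real_sqrt_le_mono)
    then show ?thesis using l2_section_le[OF x, of M] by linarith
  qed
  from l2_I[OF this] show "matrix_apply G x \<in> l2_set" "l2_norm (matrix_apply G x) \<le> l2_norm x" .
qed

lemma matrix_apply_add: "matrix_apply G (\<lambda>n. x n + y n) n = matrix_apply G x n + matrix_apply G y n"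
  by (simp add: matrix_apply_def distrib_left sum.distrib)

lemma matrix_apply_scale: "matrix_apply G (\<lambda>n. c * x n) n = c * matrix_apply G x n"
  by (simp add: matrix_apply_def sum_distrib_left mult_ac)

lemma contraction_matrix_transpose:
  assumes "contraction_matrix G"
  shows "contraction_matrix (\<lambda>m n. G n m)"
  unfolding contraction_matrix_def
proof (intro allI)
  fix N M x y
  have "(\<Sum>n<N. \<Sum>m<M. y n * G m n * x m) = (\<Sum>m<M. \<Sum>n<N. x m * G m n * y n)"
    by (subst sum.swap) (simp add: mult_ac)
  then show "(\<Sum>n<N. \<Sum>m<M. y n * G m n * x m)\<^sup>2 \<le> (\<Sum>n<N. (y n)\<^sup>2) * (\<Sum>m<M. (x m)\<^sup>2)"
    using contraction_matrixD[OF assms, where N = M and M = N and y = x and x = y] by (simp only: mult.commute)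
qed

lemma l2_truncation_tendsto:
  assumes y: "y \<in> l2_set"
  shows "(\<lambda>n. if n < N then y n else 0) \<in> l2_set"
    and "(\<lambda>N. l2_norm (\<lambda>n. y n - (if n < N then y n else 0))) \<longlonglongrightarrow> 0"
proof -
  let ?f = "\<lambda>n. (cmod (y n))\<^sup>2"
  have s: "?f sums suminf ?f" using y by (simp add: l2_set_def summable_sums)
  have cut: "(\<lambda>n. if n \<in> {..<N} then ?f n else 0) sums (\<Sum>n<N. ?f n)" for N
    by (rule sums_If_finite_set) simp
  have "(\<lambda>n. (cmod (if n < N then y n else 0))\<^sup>2) = (\<lambda>n. if n \<in> {..<N} then ?f n else 0)"
    by auto
  then show "(\<lambda>n. if n < N then y n else 0) \<in> l2_set"
    using sums_summable[OF cut[of N]] by (simp add: l2_set_def)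
  have "(\<lambda>n. (cmod (y n - (if n < N then y n else 0)))\<^sup>2) =
      (\<lambda>n. ?f n - (if n \<in> {..<N} then ?f n else 0))" for N by auto
  then have "l2_norm (\<lambda>n. y n - (if n < N then y n else 0)) = sqrt (suminf ?f - (\<Sum>n<N. ?f n))" for N
    unfolding l2_norm_def using sums_unique[OF sums_diff[OF s cut[of N]]] by simp
  moreover have "(\<lambda>N. sqrt (suminf ?f - (\<Sum>n<N. ?f n))) \<longlonglongrightarrow> sqrt (suminf ?f - suminf ?f)"
    using s by (intro tendsto_intros) (simp add: sums_def)
  ultimately show "(\<lambda>N. l2_norm (\<lambda>n. y n - (if n < N then y n else 0))) \<longlonglongrightarrow> 0" by simp
qed

text \<open>
  For a truncation of $y$ the identity is an exchange of two finite sums. The double series for $y$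
  itself need not converge absolutely; instead both sides are continuous in $y$, and the
  truncations converge to $y$ in norm.
\<close>

lemma matrix_apply_adjoint:
  assumes G: "finite_rows G" "finite_rows (\<lambda>m n. G n m)" "contraction_matrix G"
    and x: "x \<in> l2_set" and y: "y \<in> l2_set"
  shows "(\<Sum>n. matrix_apply G x n * cnj (y n)) = (\<Sum>n. x n * cnj (matrix_apply (\<lambda>m n. G n m) y n))"
proof -
  let ?H = "\<lambda>m n. G n m"
  note H = G(2) contraction_matrix_transpose[OF G(3)]
  let ?t = "\<lambda>N n. if n < N then y n else 0"
  note Gx = matrix_apply_l2[OF G(1,3) x]
  have finite_part: "(\<Sum>n<N. matrix_apply G x n * cnj (y n)) = (\<Sum>n. x n * cnj (matrix_apply ?H (?t N) n))" for N
  proof -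
    obtain M where M: "\<And>n m. n < N \<Longrightarrow> m \<ge> M \<Longrightarrow> G n m = 0"
      using finite_rows_bound[OF G(1)] by metis
    have col: "matrix_apply ?H (?t N) m = (\<Sum>n<N. of_real (G n m) * y n)" for m
    proof -
      obtain K where K: "\<And>n. n \<ge> K \<Longrightarrow> G n m = 0" "K \<ge> N"
        using finite_rows_bound[OF G(2), of "Suc m" N] by (metis lessI)
      have "matrix_apply ?H (?t N) m = (\<Sum>n<K. of_real (G n m) * ?t N n)"
        by (rule matrix_apply_eq) (rule K)
      also have "\<dots> = (\<Sum>n<N. of_real (G n m) * y n)"
        by (rule sum.mono_neutral_cong_right) (use K(2) in auto)
      finally show ?thesis .
    qed
    have "(\<Sum>n. x n * cnj (matrix_apply ?H (?t N) n)) = (\<Sum>m<M. x m * cnj (matrix_apply ?H (?t N) m))"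
      by (rule suminf_finite) (auto simp: col M)
    also have "\<dots> = (\<Sum>m<M. \<Sum>n<N. of_real (G n m) * x m * cnj (y n))"
      by (simp add: col sum_distrib_left mult_ac)
    also have "\<dots> = (\<Sum>n<N. matrix_apply G x n * cnj (y n))"
      by (subst sum.swap) (simp add: matrix_apply_eq[OF M] sum_distrib_right)
    finally show ?thesis ..
  qed
  have "(\<lambda>N. (\<Sum>n. x n * cnj (matrix_apply ?H (?t N) n)) - (\<Sum>n. x n * cnj (matrix_apply ?H y n))) \<longlonglongrightarrow> 0"
  proof (rule Lim_null_comparison)
    show "(\<lambda>N. l2_norm x * l2_norm (\<lambda>n. y n - ?t N n)) \<longlonglongrightarrow> 0"
      using tendsto_mult_right_zero[OF l2_truncation_tendsto(2)[OF y]] by simp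
    have "cmod ((\<Sum>n. x n * cnj (matrix_apply ?H (?t N) n)) - (\<Sum>n. x n * cnj (matrix_apply ?H y n)))
        \<le> l2_norm x * l2_norm (\<lambda>n. y n - ?t N n)" for N
    proof -
      let ?d = "\<lambda>n. ?t N n - y n"
      note t = l2_truncation_tendsto(1)[OF y, of N]
      have d: "?d \<in> l2_set" using l2_diff[OF t y] .
      have "(\<Sum>n. x n * cnj (matrix_apply ?H (?t N) n)) - (\<Sum>n. x n * cnj (matrix_apply ?H y n)) =
         (\<Sum>n. x n * cnj (matrix_apply ?H (?t N) n) - x n * cnj (matrix_apply ?H y n))"
        by (intro suminf_diff l2_inner_summable x matrix_apply_l2[OF H] t y)
      also have "\<dots> = (\<Sum>n. x n * cnj (matrix_apply ?H ?d n))"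
        by (simp add: matrix_apply_def right_diff_distrib sum_subtractf)
      also have "cmod \<dots> \<le> l2_norm x * l2_norm (matrix_apply ?H ?d)"
        by (intro l2_inner_summable x matrix_apply_l2[OF H] d)
      also have "\<dots> \<le> l2_norm x * l2_norm ?d"
        by (intro mult_left_mono l2_norm_nonneg[OF x] matrix_apply_l2[OF H d])
      finally show ?thesis by (simp add: l2_norm_minus_commute[of "?t N"])
    qed
    then show "\<forall>\<^sub>F N in sequentially. cmod ((\<Sum>n. x n * cnj (matrix_apply ?H (?t N) n)) - (\<Sum>n. x n * cnj (matrix_apply ?H y n)))
        \<le> l2_norm x * l2_norm (\<lambda>n. y n - ?t N n)" by simp
  qed
  then have "(\<lambda>N. \<Sum>n<N. matrix_apply G x n * cnj (y n)) \<longlonglongrightarrow> (\<Sum>n. x n * cnj (matrix_apply ?H y n))"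
    unfolding finite_part[symmetric] by (rule LIM_zero_cancel)
  moreover have "(\<lambda>N. \<Sum>n<N. matrix_apply G x n * cnj (y n)) \<longlonglongrightarrow> (\<Sum>n. matrix_apply G x n * cnj (y n))"
    by (intro summable_LIMSEQ l2_inner_summable Gx y)
  ultimately show ?thesis by (rule LIMSEQ_unique[rotated])
qed

lemma normal_matrix_commute:
  assumes G: "finite_rows G" "finite_rows (\<lambda>m n. G n m)" and norm: "normal_matrix G"
  shows "matrix_apply G (matrix_apply (\<lambda>m n. G n m) x) n = matrix_apply (\<lambda>m n. G n m) (matrix_apply G x) n"
proof -
  let ?H = "\<lambda>m n. G n m"
  obtain M1 where M1: "\<And>m. m \<ge> M1 \<Longrightarrow> G n m = 0"
    using finite_rows_bound[OF G(1), of "Suc n" 0] by (metis lessI)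
  obtain M where M2: "\<And>m. m \<ge> M \<Longrightarrow> G m n = 0" and M_ge: "M \<ge> M1"
    using finite_rows_bound[OF G(2), of "Suc n" M1] by (metis lessI)
  have M: "\<And>m. m \<ge> M \<Longrightarrow> G n m = 0" using M1 M_ge by simp
  obtain L1 where L1: "\<And>m l. m < M \<Longrightarrow> l \<ge> L1 \<Longrightarrow> G m l = 0"
    using finite_rows_bound[OF G(1), of M 0] by metis
  obtain L where L2: "\<And>m l. m < M \<Longrightarrow> l \<ge> L \<Longrightarrow> G l m = 0" and L_ge: "L \<ge> L1"
    using finite_rows_bound[OF G(2), of M L1] by metis
  have L: "\<And>m l. m < M \<Longrightarrow> l \<ge> L \<Longrightarrow> G m l = 0" using L1 L_ge by simp
  have gram: "(\<Sum>m<M. G n m * G l m) = (\<Sum>m<M. G m n * G m l)" for l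
  proof -
    obtain L0 where L0: "\<And>L. L \<ge> L0 \<Longrightarrow> (\<Sum>m<L. G n m * G l m) = (\<Sum>m<L. G m n * G m l)"
      using norm unfolding normal_matrix_def by blast
    have "(\<Sum>m<M. G n m * G l m) = (\<Sum>m<max L0 M. G n m * G l m)"
      by (rule sum.mono_neutral_left) (use M in auto)
    also have "\<dots> = (\<Sum>m<max L0 M. G m n * G m l)" by (rule L0) simp
    also have "\<dots> = (\<Sum>m<M. G m n * G m l)"
      by (rule sum.mono_neutral_right) (use M2 in auto)
    finally show ?thesis .
  qed
  have "matrix_apply G (matrix_apply ?H x) n = (\<Sum>m<M. of_real (G n m) * matrix_apply ?H x m)"
    by (rule matrix_apply_eq) (rule M)
  also have "\<dots> = (\<Sum>m<M. \<Sum>l<L. of_real (G n m * G l m) * x l)"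
    by (intro sum.cong refl) (simp add: matrix_apply_eq[where G = ?H and M = L] L2 sum_distrib_left mult_ac)
  also have "\<dots> = (\<Sum>l<L. of_real (\<Sum>m<M. G n m * G l m) * x l)"
    by (subst sum.swap) (simp add: sum_distrib_right)
  also have "\<dots> = (\<Sum>l<L. of_real (\<Sum>m<M. G m n * G m l) * x l)"
    by (simp only: gram)
  also have "\<dots> = (\<Sum>m<M. \<Sum>l<L. of_real (G m n * G m l) * x l)"
    by (subst sum.swap) (simp add: sum_distrib_right)
  also have "\<dots> = (\<Sum>m<M. of_real (G m n) * matrix_apply G x m)"
    by (intro sum.cong refl) (simp add: matrix_apply_eq[where G = G and M = L] L sum_distrib_left mult_ac)
  also have "\<dots> = matrix_apply ?H (matrix_apply G x) n"
    by (rule matrix_apply_eq[symmetric]) (rule M2)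
  finally show ?thesis .
qed

section \<open>The sequence space as a Hilbert space\<close>

text \<open>
  The space of square-summable sequences, placed in the right summand of the type over which
  subnormality is asked for. It is the space on which the normal extensions will act.
\<close>

definition ell2_copy :: "('k + (nat \<Rightarrow> complex)) inner_space"
  where "ell2_copy = \<lparr>carrier = Inr ` l2_set, mult = undefined, one = undefined,
    zero = Inr (\<lambda>n. 0), add = (\<lambda>x y. Inr (\<lambda>n. projr x n + projr y n)),
    smult = (\<lambda>c x. Inr (\<lambda>n. c * projr x n)),
    cinner = (\<lambda>x y. \<Sum>n. projr x n * cnj (projr y n))\<rparr>"

lemma ell2_copy_simps [simp]:
  "carrier ell2_copy = Inr ` l2_set"
  "\<zero>\<^bsub>ell2_copy\<^esub> = Inr (\<lambda>n. 0)"
  "add ell2_copy x y = Inr (\<lambda>n. projr x n + projr y n)"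
  "smult ell2_copy c x = Inr (\<lambda>n. c * projr x n)"
  "cinner ell2_copy x y = (\<Sum>n. projr x n * cnj (projr y n))"
  by (simp_all add: ell2_copy_def)

lemma ell2_simps [simp]:
  "carrier ell2 = l2_set"
  "add ell2 x y = (\<lambda>n. x n + y n)"
  "smult ell2 c x = (\<lambda>n. c * x n)"
  "cinner ell2 x y = (\<Sum>n. x n * cnj (y n))"
  by (simp_all add: ell2_def l2_set_def)

lemma cring_complex_field: "cring complex_field"
proof (rule cringI)
  show "abelian_group complex_field"
  proof (rule abelian_groupI)
    fix x :: complex
    show "\<exists>y\<in>carrier complex_field. y \<oplus>\<^bsub>complex_field\<^esub> x = \<zero>\<^bsub>complex_field\<^esub>"
      by (rule bexI[of _ "- x"]) (simp_all add: complex_field_def)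
  qed (simp_all add: complex_field_def)
  show "comm_monoid complex_field"
    by (rule comm_monoidI) (simp_all add: complex_field_def)
qed (simp_all add: complex_field_def distrib_right)

lemma module_ell2_copy: "module complex_field ell2_copy"
proof (rule moduleI)
  show "abelian_group (ell2_copy :: ('k + (nat \<Rightarrow> complex)) inner_space)"
  proof (rule abelian_groupI)
    fix x :: "'k + (nat \<Rightarrow> complex)" assume "x \<in> carrier ell2_copy"
    then show "\<exists>y\<in>carrier ell2_copy. y \<oplus>\<^bsub>ell2_copy\<^esub> x = \<zero>\<^bsub>ell2_copy\<^esub>"
      by (intro bexI[of _ "Inr (\<lambda>n. - projr x n)"]) auto
  qed (auto simp: add.assoc add.commute intro: l2_add imageI)
qed (auto simp: complex_field_def algebra_simps intro: l2_scale imageI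
  intro!: cring_complex_field[unfolded complex_field_def])

lemma ell2_copy_minus:
  assumes "x \<in> carrier ell2_copy" "y \<in> carrier ell2_copy"
  shows "x \<ominus>\<^bsub>ell2_copy\<^esub> y = Inr (\<lambda>n. projr x n - projr y n)"
proof -
  interpret module complex_field ell2_copy by (rule module_ell2_copy)
  have "\<ominus>\<^bsub>ell2_copy\<^esub> y = Inr (\<lambda>n. - projr y n)"
    by (rule M.minus_equality) (use assms in auto)
  then show ?thesis by (simp add: a_minus_def)
qed

lemma hnorm_ell2_copy: 
  "x \<in> carrier ell2_copy \<Longrightarrow> hnorm ell2_copy x = l2_norm (projr x)"
  unfolding hnorm_def l2_norm_def 
  using Re_suminf[of "\<lambda>n. projr x n * cnj (projr x n)"] l2_inner_summable(2)[of "projr x" "projr x"]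
  by (auto simp: complex_mult_cnj cmod_power2)

lemma hdist_ell2_copy:
  fixes x y :: "'k + (nat \<Rightarrow> complex)"
  assumes "x \<in> carrier ell2_copy" "y \<in> carrier ell2_copy"
  shows "hdist ell2_copy x y = l2_norm (\<lambda>n. projr x n - projr y n)"
proof -
  have "(Inr (\<lambda>n. projr x n - projr y n) :: 'k + (nat \<Rightarrow> complex)) \<in> carrier ell2_copy"
    using assms by (auto intro!: imageI l2_diff)
  then show ?thesis
    using assms by (simp add: hdist_def ell2_copy_minus hnorm_ell2_copy del: ell2_copy_simps(1))
qed

lemma Metric_space_ell2_copy: "Metric_space (carrier ell2_copy) (hdist ell2_copy)"
proof
  fix x y z :: "'k + (nat \<Rightarrow> complex)"
  show "0 \<le> hdist ell2_copy x y"
  proof (cases "x \<in> carrier ell2_copy \<and> y \<in> carrier ell2_copy")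
    case True
    then show ?thesis by (auto simp: hdist_ell2_copy intro!: l2_norm_nonneg l2_diff)
  qed (auto simp: hdist_def)
  show "hdist ell2_copy x y = hdist ell2_copy y x"
  proof (cases "x \<in> carrier ell2_copy \<and> y \<in> carrier ell2_copy")
    case True
    then show ?thesis by (simp add: hdist_ell2_copy l2_norm_minus_commute[of "projr x"] del: ell2_copy_simps(1))
  qed (auto simp: hdist_def)
  assume x: "x \<in> carrier ell2_copy" and y: "y \<in> carrier ell2_copy"
  then obtain x' y' where xy: "x = Inr x'" "y = Inr y'" "x' \<in> l2_set" "y' \<in> l2_set" by auto
  show "hdist ell2_copy x y = 0 \<longleftrightarrow> x = y"
  proof
    assume "hdist ell2_copy x y = 0"
    then have "x' n - y' n = 0" for n
      using l2_norm_eq_0[OF l2_diff[OF xy(3,4)]] hdist_ell2_copy[OF x y] xy by simp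
    then show "x = y" by (simp add: xy fun_eq_iff)
  qed (simp add: hdist_ell2_copy[OF y y] l2_norm_def)
  assume z: "z \<in> carrier ell2_copy"
  then obtain z' where z': "z = Inr z'" "z' \<in> l2_set" by auto
  show "hdist ell2_copy x z \<le> hdist ell2_copy x y + hdist ell2_copy y z"
    using l2_add(2)[OF l2_diff[OF xy(3,4)] l2_diff[OF xy(4) z'(2)]]
    unfolding hdist_ell2_copy[OF x y] hdist_ell2_copy[OF x z] hdist_ell2_copy[OF y z]
    by (simp add: xy z')
qed

lemma hilbert_space_ell2_copy:
  "hilbert_space (ell2_copy :: ('k + (nat \<Rightarrow> complex)) inner_space)"
proof -
  let ?K = "ell2_copy :: ('k + (nat \<Rightarrow> complex)) inner_space"
  have complete: "Metric_space.mcomplete (carrier ?K) (hdist ?K)"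
    unfolding Metric_space.mcomplete_def[OF Metric_space_ell2_copy]
  proof (intro allI impI)
    fix s assume "Metric_space.MCauchy (carrier ?K) (hdist ?K) s"
    then have s: "range s \<subseteq> carrier ?K"
      and cauchy: "\<And>e. e > 0 \<Longrightarrow> \<exists>N. \<forall>n n'. N \<le> n \<longrightarrow> N \<le> n' \<longrightarrow> hdist ?K (s n) (s n') < e"
      unfolding Metric_space.MCauchy_def[OF Metric_space_ell2_copy] by blast+
    have s': "s k \<in> carrier ?K" for k using s by auto
    then have x: "projr (s k) \<in> l2_set" for k by (metis (no_types, lifting) ell2_copy_simps(1) imageE sum.sel(2))
    obtain y where y: "y \<in> l2_set"
      and lim: "\<And>e. e > 0 \<Longrightarrow> \<exists>K. \<forall>k\<ge>K. l2_norm (\<lambda>n. projr (s k) n - y n) < e"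
    proof (rule l2_complete[of "\<lambda>k. projr (s k)"])
      show "\<exists>K. \<forall>k\<ge>K. \<forall>l\<ge>K. l2_norm (\<lambda>n. projr (s k) n - projr (s l) n) < e" if "e > 0" for e
        using cauchy[OF that] unfolding hdist_ell2_copy[OF s' s'] by blast
    qed (rule x, rule that)
    have y': "Inr y \<in> carrier ?K" using y by simp
    have "limitin (Metric_space.mtopology (carrier ?K) (hdist ?K)) s (Inr y) sequentially"
      unfolding Metric_space.limit_metric_sequentially[OF Metric_space_ell2_copy]
      using y' s' lim by (simp add: hdist_ell2_copy[OF s' y'] del: ell2_copy_simps)
    then show "\<exists>x. limitin (Metric_space.mtopology (carrier ?K) (hdist ?K)) s x sequentially" by blast
  qed
  interpret module complex_field ?K by (rule module_ell2_copy)
  show ?thesis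
  proof
    fix x y z :: "'k + (nat \<Rightarrow> complex)" and c
    assume "x \<in> carrier ?K"
    then obtain x' where x: "x = Inr x'" "x' \<in> l2_set" by auto
    show "Re (cinner ?K x x) \<ge> 0"
      using Re_suminf[OF l2_inner_summable(2)[OF x(2) x(2)]] x(2)
      by (auto simp: x complex_mult_cnj l2_set_def cmod_power2 intro!: suminf_nonneg)
    show "x = \<zero>\<^bsub>?K\<^esub>" if "cinner ?K x x = 0"
    proof -
      have "l2_norm x' = 0"
        using hnorm_ell2_copy[of x] that x by (simp add: hnorm_def)
      then show ?thesis using l2_norm_eq_0[OF x(2)] by (auto simp: x)
    qed
    assume "y \<in> carrier ?K"
    then obtain y' where y: "y = Inr y'" "y' \<in> l2_set" by auto
    note sm = l2_inner_summable(2)[OF x(2) y(2)]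
    show "cinner ?K (c \<odot>\<^bsub>?K\<^esub> x) y = c * cinner ?K x y"
      using suminf_mult[OF sm, of c] by (simp add: x y mult.assoc)
    show "cinner ?K x y = cnj (cinner ?K y x)"
      using bounded_linear.suminf[OF bounded_linear_cnj l2_inner_summable(2)[OF y(2) x(2)]]
      by (simp add: x y mult.commute)
    assume "z \<in> carrier ?K"
    then obtain z' where z: "z = Inr z'" "z' \<in> l2_set" by auto
    show "cinner ?K (x \<oplus>\<^bsub>?K\<^esub> y) z = cinner ?K x z + cinner ?K y z"
      using suminf_add[OF l2_inner_summable(2)[OF x(2) z(2)] l2_inner_summable(2)[OF y(2) z(2)]]
      by (simp add: x y z distrib_right)
  qed (rule complete)
qed

section \<open>Subnormal shifts from normal matrices\<close>

definition copy_operator :: "(nat \<Rightarrow> nat \<Rightarrow> real) \<Rightarrow> 'k + (nat \<Rightarrow> complex) \<Rightarrow> 'k + (nat \<Rightarrow> complex)"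
  where "copy_operator G x = Inr (matrix_apply G (projr x))"

lemma bounded_copy_operator:
  assumes "finite_rows G" "contraction_matrix G"
  shows "bounded_operator ell2_copy (copy_operator G)"
proof -
  have maps: "copy_operator G x \<in> carrier ell2_copy" if "x \<in> carrier ell2_copy" for x :: "'k + (nat \<Rightarrow> complex)"
    using that matrix_apply_l2(1)[OF assms] by (auto simp: copy_operator_def)
  have "complex_linear ell2_copy ell2_copy (copy_operator G)"
    unfolding complex_linear_def
    using matrix_apply_l2(1)[OF assms] by (auto simp: copy_operator_def matrix_apply_add matrix_apply_scale)
  moreover have "hnorm ell2_copy (copy_operator G x) \<le> 1 * hnorm ell2_copy x"
    if "x \<in> carrier ell2_copy" for x :: "'k + (nat \<Rightarrow> complex)"
    unfolding hnorm_ell2_copy[OF that] hnorm_ell2_copy[OF maps[OF that]]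
    using matrix_apply_l2(2)[OF assms, of "projr x"] that by (auto simp: copy_operator_def)
  ultimately show ?thesis unfolding bounded_operator_def by blast
qed

lemma normal_copy_operator:
  assumes G: "finite_rows G" "finite_rows (\<lambda>m n. G n m)" "contraction_matrix G" "normal_matrix G"
  shows "normal_operator ell2_copy (copy_operator G)"
  unfolding normal_operator_def is_adjoint_def
proof (intro conjI exI[of _ "copy_operator (\<lambda>m n. G n m)"] ballI)
  show "bounded_operator ell2_copy (copy_operator G)"
    by (rule bounded_copy_operator[OF G(1,3)])
  show "bounded_operator ell2_copy (copy_operator (\<lambda>m n. G n m))"
    by (rule bounded_copy_operator[OF G(2) contraction_matrix_transpose[OF G(3)]])
  fix x y :: "'k + (nat \<Rightarrow> complex)"
  show "copy_operator G (copy_operator (\<lambda>m n. G n m) x) = copy_operator (\<lambda>m n. G n m) (copy_operator G x)"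
    unfolding copy_operator_def using normal_matrix_commute[OF G(1,2,4)] by (auto simp: fun_eq_iff)
  assume "x \<in> carrier ell2_copy" "y \<in> carrier ell2_copy"
  then show "cinner ell2_copy (copy_operator G x) y = cinner ell2_copy x (copy_operator (\<lambda>m n. G n m) y)"
    using matrix_apply_adjoint[OF G(1-3)] by (auto simp: copy_operator_def)
qed

text \<open>
  The isometric embedding of the sequence space that sends the $n$-th unit vector to the one with
  index $p(n)$.
\<close>

definition spread :: "(nat \<Rightarrow> nat) \<Rightarrow> (nat \<Rightarrow> complex) \<Rightarrow> nat \<Rightarrow> complex"
  where "spread p x l = (if l \<in> range p then x (inv_into UNIV p l) else 0)"

lemma spread_at: "strict_mono p \<Longrightarrow> spread p x (p n) = x n"
  by (simp add: spread_def strict_mono_imp_inj_on inv_f_f)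

lemma spread_off: "l \<notin> range p \<Longrightarrow> spread p x l = 0"
  by (simp add: spread_def)

lemma spread_l2:
  assumes "strict_mono p"
  shows "spread p x \<in> l2_set \<longleftrightarrow> x \<in> l2_set"
  using summable_mono_reindex[OF assms, of "\<lambda>l. (cmod (spread p x l))\<^sup>2"]
  by (simp add: l2_set_def spread_at[OF assms] spread_off)

text \<open>
  The matrix maps the unit vector at $p(n)$ to $\beta_n$ times the unit vector at $p(n+1)$, hence it
  restricts to the weighted shift on the closed span of these unit vectors. That span consists of
  the sequences that vanish off the range of $p$, a condition on coordinates and therefore closed.
\<close>

lemma subnormal_weighted_shift:
  assumes p: "strict_mono p"
    and G: "finite_rows G" "finite_rows (\<lambda>m n. G n m)" "contraction_matrix G" "normal_matrix G"
    and col: "\<And>l n. G l (p n) = (if l = p (Suc n) then \<beta> n else 0)"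
  shows "subnormal TYPE('k + (nat \<Rightarrow> complex)) ell2 (weighted_shift \<beta>)"
proof -
  let ?K = "ell2_copy :: ('k + (nat \<Rightarrow> complex)) inner_space"
  let ?N = "copy_operator G :: 'k + (nat \<Rightarrow> complex) \<Rightarrow> _"
  define M :: "('k + (nat \<Rightarrow> complex)) set" where "M = {Inr c | c. c \<in> l2_set \<and> (\<forall>l. l \<notin> range p \<longrightarrow> c l = 0)}"
  define V :: "(nat \<Rightarrow> complex) \<Rightarrow> 'k + (nat \<Rightarrow> complex)" where "V x = Inr (spread p x)" for x
  have inj: "inj p" using p by (rule strict_mono_imp_inj_on)
  have MV: "M = V ` l2_set"
  proof
    show "M \<subseteq> V ` l2_set"
    proof
      fix m assume "m \<in> M"
      then obtain c where c: "m = Inr c" "c \<in> l2_set" "\<And>l. l \<notin> range p \<Longrightarrow> c l = 0"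
        by (auto simp: M_def)
      have "spread p (\<lambda>n. c (p n)) = c"
        using c(3) by (auto simp: spread_def fun_eq_iff f_inv_into_f)
      then show "m \<in> V ` l2_set"
        using c(1,2) spread_l2[OF p, of "\<lambda>n. c (p n)"] by (metis V_def imageI)
    qed
    show "V ` l2_set \<subseteq> M"
      using spread_l2[OF p] by (auto simp: M_def V_def spread_off)
  qed
  have intertwine: "V (weighted_shift \<beta> x) = ?N (V x)" for x
  proof -
    have "matrix_apply G (spread p x) l = spread p (weighted_shift \<beta> x) l" for l
    proof -
      have term_eq: "of_real (G l m) * spread p x m =
          (if m \<in> p ` {n. l = p (Suc n)} then of_real (\<beta> (inv_into UNIV p m)) * x (inv_into UNIV p m) else 0)" for m
      proof (cases "m \<in> range p")
        case True
        then obtain n where n: "m = p n" by auto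
        show ?thesis unfolding n using inj
          by (auto simp: col spread_at[OF p] inv_f_f dest: injD)
      next
        case False
        then show ?thesis by (auto simp: spread_off)
      qed
      show ?thesis
      proof (cases "\<exists>n. l = p (Suc n)")
        case True
        then obtain n where n: "l = p (Suc n)" by auto
        then have set: "p ` {n. l = p (Suc n)} = {p n}" using inj by (auto dest: injD)
        have "matrix_apply G (spread p x) l = (\<Sum>m | G l m \<noteq> 0. if m = p n then of_real (\<beta> n) * x n else 0)"
          unfolding matrix_apply_def term_eq set by (intro sum.cong) (auto simp: inv_f_f[OF inj])
        also have "\<dots> = of_real (\<beta> n) * x n"
        proof -
          have "finite {m. G l m \<noteq> 0}"
            using finite_rows_bound[OF G(1), of "Suc l" 0]
            by (metis (mono_tags, lifting) finite_nat_set_iff_bounded lessI mem_Collect_eq not_less)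
          then show ?thesis by (auto simp: col n)
        qed
        also have "\<dots> = spread p (weighted_shift \<beta> x) l"
          by (simp add: n spread_at[OF p] weighted_shift_def)
        finally show ?thesis .
      next
        case False
        then have "matrix_apply G (spread p x) l = 0"
          unfolding matrix_apply_def term_eq by (intro sum.neutral) auto
        also have "0 = spread p (weighted_shift \<beta> x) l"
        proof (cases "l \<in> range p")
          case True
          then obtain k where k: "l = p k" by auto
          with False have "k = 0" by (cases k) auto
          then show ?thesis by (simp add: k spread_at[OF p] weighted_shift_def)
        qed (simp add: spread_off)
        finally show ?thesis .
      qed
    qed
    then show ?thesis by (auto simp: V_def copy_operator_def)
  qed
  have inner: "cinner ?K (V x) (V y) = cinner ell2 x y" for x y
    using suminf_mono_reindex[OF p, of "\<lambda>l. spread p x l * cnj (spread p y l)"]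
    by (simp add: V_def spread_at[OF p] spread_off)
  have unitary: "unitary_onto ell2 ?K M V"
    unfolding unitary_onto_def complex_linear_def
  proof (intro conjI ballI allI)
    show "V \<in> carrier ell2 \<rightarrow> carrier ?K"
      using spread_l2[OF p] by (auto simp: V_def)
    show "bij_betw V (carrier ell2) M"
      unfolding bij_betw_def
    proof
      show "inj_on V (carrier ell2)"
        by (rule inj_onI) (metis V_def spread_at[OF p] ext sum.inject(2))
    qed (simp add: MV)
    show "cinner ?K (V x) (V y) = cinner ell2 x y" for x y by (rule inner)
  qed (auto simp: V_def spread_def fun_eq_iff)
  interpret module complex_field ?K by (rule module_ell2_copy)
  have M_sub: "M \<subseteq> carrier ?K" by (auto simp: M_def)
  have closed: "closed_subspace M ?K"
    unfolding closed_subspace_def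
  proof
    show "submodule M complex_field ?K"
    proof (rule submoduleI)
      show "\<zero>\<^bsub>?K\<^esub> \<in> M" by (auto simp: M_def)
      show "\<ominus>\<^bsub>?K\<^esub> a \<in> M" if "a \<in> M" for a
      proof -
        have "\<ominus>\<^bsub>?K\<^esub> a = Inr (\<lambda>n. - projr a n)"
          by (rule M.minus_equality) (use that in \<open>auto simp: M_def\<close>)
        then show ?thesis using that by (auto simp: M_def)
      qed
      show "a \<oplus>\<^bsub>?K\<^esub> b \<in> M" if "a \<in> M" "b \<in> M" for a b
        using that by (auto simp: M_def intro!: CollectI l2_add)
      show "c \<odot>\<^bsub>?K\<^esub> a \<in> M" if "a \<in> M" for c a
        using that by (auto simp: M_def intro!: CollectI l2_scale)
    qed (rule M_sub)
    show "closedin (Metric_space.mtopology (carrier ?K) (hdist ?K)) M"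
      unfolding Metric_space.metric_closedin_iff_sequentially_closed[OF Metric_space_ell2_copy]
    proof (intro conjI allI impI, rule M_sub, elim conjE)
      fix s l assume s: "range s \<subseteq> M"
        and lim: "limitin (Metric_space.mtopology (carrier ?K) (hdist ?K)) s l sequentially"
      then have l: "l \<in> carrier ?K"
        and conv: "\<And>e. e > 0 \<Longrightarrow> \<exists>N. \<forall>n\<ge>N. s n \<in> carrier ?K \<and> hdist ?K (s n) l < e"
        unfolding Metric_space.limit_metric_sequentially[OF Metric_space_ell2_copy] by blast+
      obtain c where c: "l = Inr c" "c \<in> l2_set" using l by auto
      have "c j = 0" if j: "j \<notin> range p" for j
      proof (rule ccontr)
        assume "c j \<noteq> 0"
        then obtain n where n: "hdist ?K (s n) l < cmod (c j)" using conv[of "cmod (c j)"] by auto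
        have "s n \<in> M" using s by auto
        then obtain b where b: "s n = Inr b" "b \<in> l2_set" "b j = 0" using j by (auto simp: M_def)
        have "cmod (b j - c j) \<le> hdist ?K (s n) l"
          using l2_coordinate_le[OF l2_diff[OF b(2) c(2)], of j] b c by (simp add: hdist_ell2_copy)
        then show False using n b(3) by simp
      qed
      then show "l \<in> M" using c by (auto simp: M_def)
    qed
  qed
  have bounded: "bounded_operator ?K ?N" by (rule bounded_copy_operator[OF G(1,3)])
  have invariant: "?N ` M \<subseteq> M"
  proof
    fix m assume "m \<in> ?N ` M"
    then obtain x where x: "x \<in> l2_set" "m = ?N (V x)" by (auto simp: MV)
    have "m \<in> carrier ?K"
      using bounded spread_l2[OF p] x
      unfolding bounded_operator_def complex_linear_def by (auto simp: V_def)
    then have "spread p (weighted_shift \<beta> x) \<in> l2_set"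
      unfolding x(2) intertwine[symmetric] by (auto simp: V_def)
    then show "m \<in> M"
      unfolding MV x(2) intertwine[symmetric] using spread_l2[OF p] by blast
  qed
  show ?thesis
    unfolding subnormal_def
    using hilbert_space_ell2_copy normal_copy_operator[OF G] closed invariant unitary intertwine by blast
qed

lemma moment_pos: "(\<And>n. \<alpha> n > 0) \<Longrightarrow> moment \<alpha> n > 0"
  unfolding moment_def by (intro prod_pos zero_less_power)

text \<open>
  The pairs $(a,b)$ are enumerated by the Cantor pairing function. The vectors $z^n$, with indices
  $(n,0)$, are mutually orthogonal, and $z^n$ is orthogonal to all $z^a \bar z^b$ except those with
  $a = n + b$, which for $b > 0$ come later in the enumeration. So the factorization turns $z^n$ into a
  multiple of a unit vector, and multiplication by $z$ acts on these unit vectors as the weighted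
  shift. It is a contraction because $g_n - g_{n+1}$ is completely monotone, too.
\<close>

lemma completely_monotone_shift_subnormal:
  assumes cm: "completely_monotone (moment \<beta>)" and pos: "\<And>n. \<beta> n > 0"
  shows "subnormal TYPE('k + (nat \<Rightarrow> complex)) ell2 (weighted_shift \<beta>)"
proof -
  define g where "g = moment \<beta>"
  define k where "k i j = shift_kernel g (prod_decode i) (prod_decode j)" for i j
  define \<sigma> where "\<sigma> i = prod_encode (fst (prod_decode i), Suc (snd (prod_decode i)))" for i
  define \<tau> where "\<tau> i = prod_encode (Suc (fst (prod_decode i)), snd (prod_decode i))" for i
  define p where "p n = prod_encode (n, 0)" for n
  have gpos: "g n > 0" for n unfolding g_def using pos by (rule moment_pos)
  have inj: "inj prod_decode" by (rule inj_prod_decode)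
  have k_pos: "positive_kernel k"
    unfolding k_def using positive_kernel_pullback[OF positive_shift_kernel inj] cm by (simp add: g_def)
  have k_sym: "symmetric_kernel k"
    by (auto simp: symmetric_kernel_def k_def shift_kernel_def add.commute)
  have "k i j - k (\<sigma> i) (\<sigma> j) = shift_kernel (\<lambda>n. g n - g (Suc n)) (prod_decode i) (prod_decode j)" for i j
    by (auto simp: k_def \<sigma>_def shift_kernel_def)
  then have k_contr: "positive_kernel (\<lambda>i j. k i j - k (\<sigma> i) (\<sigma> j))"
    using positive_kernel_pullback[OF positive_shift_kernel[OF completely_monotone_diff] inj] cm
    by (simp add: g_def)
  have adj: "k (\<sigma> i) j = k i (\<tau> j)" for i j
    by (auto simp: k_def \<sigma>_def \<tau>_def shift_kernel_def)
  have comm: "k (\<sigma> i) (\<sigma> j) = k (\<tau> i) (\<tau> j)" for i j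
    by (auto simp: k_def \<sigma>_def \<tau>_def shift_kernel_def)
  have p_mono: "strict_mono p"
    unfolding strict_mono_Suc_iff by (simp add: p_def prod_encode_def)
  have \<tau>p: "\<tau> (p n) = p (Suc n)" for n by (simp add: \<tau>_def p_def)
  have kpp: "k (p n) (p n) = g n" for n by (simp add: k_def p_def shift_kernel_def)
  have low: "k (p n) j = 0" if "j < p n" for n j
  proof (rule ccontr)
    obtain a b where ab: "prod_decode j = (a, b)" by fastforce
    then have j: "j = prod_encode (a, b)" by (metis prod_decode_inverse)
    assume "k (p n) j \<noteq> 0"
    then have "a = n + b" by (auto simp: k_def p_def shift_kernel_def ab split: if_splits)
    moreover have "prod_encode (n, 0) \<le> prod_encode (n + b, b)"
      by (induction b) (auto simp: prod_encode_def)
    ultimately show False using that by (simp add: j p_def)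
  qed
  obtain G where G: "finite_rows G" "finite_rows (\<lambda>m n. G n m)" "contraction_matrix G"
    and normal: "normal_matrix G"
    and col: "\<And>q l. \<lbrakk>orthogonal_to_earlier k q; orthogonal_to_earlier k (\<tau> q)\<rbrakk>
      \<Longrightarrow> G l q = (if l = \<tau> q then sqrt (k (\<tau> q) (\<tau> q) / k q q) else 0)"
    by (rule kernel_shift_matrix[OF k_pos k_sym k_contr adj comm]) (rule that)
  have "G l (p n) = (if l = p (Suc n) then \<beta> n else 0)" for l n
  proof -
    have "g (Suc n) / g n = (\<beta> n)\<^sup>2"
    proof -
      have "g (Suc n) = g n * (\<beta> n)\<^sup>2" by (simp add: g_def moment_def)
      then show ?thesis using gpos[of n] by simp
    qed
    then show ?thesis
      using col[of "p n" l] low gpos pos[of n] by (simp add: \<tau>p kpp orthogonal_to_earlier_def)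
  qed
  then show ?thesis
    by (intro subnormal_weighted_shift[OF p_mono G normal])
qed

section \<open>Orbits of normal operators\<close>

text \<open>
  By convexity a positive increment persists, which forces linear growth.
\<close>

lemma convex_bounded_decreasing:
  fixes a :: "nat \<Rightarrow> real"
  assumes convex: "\<And>i. a i - 2 * a (Suc i) + a (Suc (Suc i)) \<ge> 0" and bound: "\<And>i. a i \<le> C"
  shows "a (Suc k) \<le> a k"
proof (rule ccontr)
  define \<delta> where "\<delta> = a (Suc k) - a k"
  assume "\<not> a (Suc k) \<le> a k"
  then have pos: "\<delta> > 0" by (simp add: \<delta>_def)
  have slope: "a (Suc (k + j)) - a (k + j) \<ge> \<delta>" for j
  proof (induction j)
    case (Suc j)
    then show ?case using convex[of "k + j"] by simp
  qed (simp add: \<delta>_def)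
  have growth: "a (k + j) \<ge> a k + real j * \<delta>" for j
  proof (induction j)
    case (Suc j)
    then show ?case using slope[of j] by (simp add: algebra_simps)
  qed simp
  obtain j where "real j * \<delta> > C - a k" using reals_Archimedean3[OF pos] by blast
  then show False using growth[of j] bound[of "k + j"] by simp
qed

context hilbert_space
begin

definition quadratic :: "'a \<Rightarrow> real"
  where "quadratic x = Re (cinner H x x)"

lemma add_diff_cancel_carrier:
  "x \<in> carrier H \<Longrightarrow> y \<in> carrier H \<Longrightarrow> (x \<ominus>\<^bsub>H\<^esub> y) \<oplus>\<^bsub>H\<^esub> y = x"
  by (simp add: a_minus_def M.a_assoc M.l_neg)

lemma cinner_diff_left:
  assumes "x \<in> carrier H" "y \<in> carrier H" "z \<in> carrier H"
  shows "cinner H (x \<ominus>\<^bsub>H\<^esub> y) z = cinner H x z - cinner H y z"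
  using cinner_add_left[of "x \<ominus>\<^bsub>H\<^esub> y" y z] assms by (simp add: add_diff_cancel_carrier)

lemma cinner_diff_right:
  assumes "x \<in> carrier H" "y \<in> carrier H" "z \<in> carrier H"
  shows "cinner H z (x \<ominus>\<^bsub>H\<^esub> y) = cinner H z x - cinner H z y"
  using assms cinner_diff_left[of x y z] cinner_commute[of z] by simp

lemma quadratic_diff:
  assumes "x \<in> carrier H" "y \<in> carrier H"
  shows "quadratic (x \<ominus>\<^bsub>H\<^esub> y) = quadratic x - 2 * Re (cinner H x y) + quadratic y"
  using assms cinner_commute[of y x]
  by (simp add: quadratic_def cinner_diff_left cinner_diff_right)

text \<open>
  The normal operator itself need not be a contraction, only the orbit of $w$ is known to be
  bounded. Put $B = 1 - N^*N$. Since $N$ is normal, $\|N^*Nu\| = \|N^2u\|$ and therefore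
  $\|Bu\|^2 = \|u\|^2 - 2\|Nu\|^2 + \|N^2u\|^2$; moreover $B$ commutes with $N$. So the sequence
  $\|N^iBu\|^2$ is the second difference of $\|N^iu\|^2$. Its nonnegativity means that $\|N^iu\|^2$
  is convex, and a bounded convex sequence decreases: this settles the differences of order 1. The
  orbit of $Bu$ is bounded again, so the differences of order $n+2$ for $u$ reduce to those of
  order $n$ for $Bu$.
\<close>

lemma normal_orbit_completely_monotone:
  assumes N: "normal_operator H N" and w: "w \<in> carrier H"
    and bound: "\<And>i. quadratic ((N ^^ i) w) \<le> C"
  shows "completely_monotone (\<lambda>i. quadratic ((N ^^ i) w))"
proof -
  obtain S where S: "is_adjoint H N S" and comm: "\<And>x. x \<in> carrier H \<Longrightarrow> N (S x) = S (N x)"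
    using N unfolding normal_operator_def by blast
  have N_closed: "N x \<in> carrier H" if "x \<in> carrier H" for x
    using N that by (auto simp: normal_operator_def bounded_operator_def complex_linear_def)
  have S_closed: "S x \<in> carrier H" if "x \<in> carrier H" for x
    using S that by (auto simp: is_adjoint_def bounded_operator_def complex_linear_def)
  have N_add: "N (x \<oplus>\<^bsub>H\<^esub> y) = N x \<oplus>\<^bsub>H\<^esub> N y" if "x \<in> carrier H" "y \<in> carrier H" for x y
    using N that by (auto simp: normal_operator_def bounded_operator_def complex_linear_def)
  have adj: "cinner H (N x) y = cinner H x (S y)" if "x \<in> carrier H" "y \<in> carrier H" for x y
    using S that by (auto simp: is_adjoint_def)
  have adj': "cinner H (S y) x = cinner H y (N x)" if "x \<in> carrier H" "y \<in> carrier H" for x y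
    using adj[OF that] that by (metis cinner_commute N_closed S_closed)
  have N_diff: "N (x \<ominus>\<^bsub>H\<^esub> y) = N x \<ominus>\<^bsub>H\<^esub> N y" if "x \<in> carrier H" "y \<in> carrier H" for x y
  proof -
    have "N x = N (x \<ominus>\<^bsub>H\<^esub> y) \<oplus>\<^bsub>H\<^esub> N y"
      using N_add[of "x \<ominus>\<^bsub>H\<^esub> y" y] that by (simp add: add_diff_cancel_carrier)
    then show ?thesis
      using that by (simp add: a_minus_def M.a_assoc M.r_neg N_closed)
  qed
  define B where "B u = u \<ominus>\<^bsub>H\<^esub> S (N u)" for u
  have B_closed: "B u \<in> carrier H" if "u \<in> carrier H" for u
    using that by (simp add: B_def N_closed S_closed)
  have power_closed: "(N ^^ i) u \<in> carrier H" if "u \<in> carrier H" for i u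
    by (induction i) (use that in \<open>auto simp: N_closed\<close>)
  have quadratic_B: "quadratic (B u) = quadratic u - 2 * quadratic (N u) + quadratic (N (N u))"
    if "u \<in> carrier H" for u
  proof -
    note c = that N_closed[OF that] N_closed[OF N_closed[OF that]]
    have "cinner H u (S (N u)) = cinner H (N u) (N u)" by (simp add: adj c)
    moreover have "cinner H (S (N u)) (S (N u)) = cinner H (N (N u)) (N (N u))"
      by (simp add: adj[symmetric] adj' comm c S_closed)
    ultimately show ?thesis
      by (simp add: B_def quadratic_diff c S_closed) (simp add: quadratic_def)
  qed
  have N_B: "N (B u) = B (N u)" if "u \<in> carrier H" for u
    using that by (simp add: B_def N_diff comm N_closed S_closed)
  have power_B: "(N ^^ i) (B u) = B ((N ^^ i) u)" if "u \<in> carrier H" for i u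
    by (induction i) (simp_all add: N_B power_closed[OF that])
  define a where "a u i = quadratic ((N ^^ i) u)" for u i
  have a_B: "a (B u) i = a u i - 2 * a u (Suc i) + a u (Suc (Suc i))" if "u \<in> carrier H" for u i
    by (simp add: a_def power_B[OF that] quadratic_B power_closed[OF that])
  have a_nonneg: "a u i \<ge> 0" if "u \<in> carrier H" for u i
    using cinner_nonneg power_closed[OF that] by (simp add: a_def quadratic_def)
  have "bdiff n (a u) k \<ge> 0" if "u \<in> carrier H" "\<And>i. a u i \<le> C" for n k u C
    using that
  proof (induction n arbitrary: u C rule: induct_nat_012)
    case 0
    then show ?case by (simp add: a_nonneg)
  next
    case 1
    have "a u (Suc k) \<le> a u k"
    proof (rule convex_bounded_decreasing)
      show "a u i - 2 * a u (Suc i) + a u (Suc (Suc i)) \<ge> 0" for i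
        using a_nonneg[OF B_closed[OF 1(1)], of i] a_B[OF 1(1)] by simp
    qed (rule 1)
    then show ?case by simp
  next
    case (ge2 n)
    have "bdiff n (a (B u)) k \<ge> 0"
    proof (rule ge2(1)[OF B_closed[OF ge2(3)]])
      show "a (B u) i \<le> 2 * C" for i
        using a_nonneg[OF ge2(3), of "Suc i"] ge2(4)[of i] ge2(4)[of "Suc (Suc i)"]
        by (simp add: a_B[OF ge2(3)])
    qed
    moreover have "a (B u) = (\<lambda>j. a u j - a u (Suc j) - (a u (Suc j) - a u (Suc (Suc j))))"
      by (simp add: fun_eq_iff a_B[OF ge2(3)])
    ultimately show ?case by simp
  qed
  then have "bdiff n (a w) k \<ge> 0" for n k
    using w bound unfolding a_def by blast
  then show ?thesis by (simp add: completely_monotone_def a_def[abs_def])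
qed

end

section \<open>Moments of weighted shifts\<close>

lemma l2_single:
  "(\<lambda>k. if k = i then c else 0) \<in> l2_set"
  "(\<Sum>k. (if k = i then c else 0) * cnj (if k = i then c else 0)) = of_real ((cmod c)\<^sup>2)"
proof -
  have "(\<lambda>k. (cmod (if k = i then c else 0))\<^sup>2) = (\<lambda>k. if k = i then (cmod c)\<^sup>2 else 0)" by auto
  then show "(\<lambda>k. if k = i then c else 0) \<in> l2_set"
    using sums_summable[OF sums_single[of i "\<lambda>_. (cmod c)\<^sup>2"]] by (simp add: l2_set_def)
  have "(\<lambda>k. (if k = i then c else 0) * cnj (if k = i then c else 0)) = (\<lambda>k. if k = i then of_real ((cmod c)\<^sup>2) else 0)"
    by (auto simp: fun_eq_iff complex_norm_square[symmetric])
  then show "(\<Sum>k. (if k = i then c else 0) * cnj (if k = i then c else 0)) = of_real ((cmod c)\<^sup>2)"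
    using sums_unique[OF sums_single[of i "\<lambda>_. complex_of_real ((cmod c)\<^sup>2)"]] by simp
qed

lemma weighted_shift_power:
  "(weighted_shift \<beta> ^^ i) (basis_vector 0) = (\<lambda>k. if k = i then of_real (\<Prod>j<i. \<beta> j) else 0)"
  by (induction i) (auto simp: basis_vector_def weighted_shift_def fun_eq_iff split: nat.split)

text \<open>
  The moments are the squared norms along the orbit of the first unit vector, and the isometry
  carries this orbit to one of the normal extension.
\<close>

lemma subnormal_shift_completely_monotone:
  assumes sub: "subnormal u ell2 (weighted_shift \<beta>)" and le: "\<And>n. \<bar>\<beta> n\<bar> \<le> 1"
  shows "completely_monotone (moment \<beta>)"
proof -
  let ?W = "weighted_shift \<beta>"
  obtain K :: "'a inner_space" and N M V where K: "hilbert_space K" and N: "normal_operator K N"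
    and V: "unitary_onto ell2 K M V" and VT: "\<And>x. x \<in> carrier ell2 \<Longrightarrow> V (?W x) = N (V x)"
    using sub unfolding subnormal_def by blast
  interpret hilbert_space K by (rule K)
  let ?e = "basis_vector 0"
  have e: "(?W ^^ i) ?e \<in> carrier ell2" for i
    by (simp add: weighted_shift_power l2_single)
  have orbit: "(N ^^ i) (V ?e) = V ((?W ^^ i) ?e)" for i
    by (induction i) (simp_all add: VT[OF e])
  have V_mem: "V ?e \<in> carrier K"
    using V e[of 0] by (auto simp: unitary_onto_def complex_linear_def)
  have quad: "quadratic ((N ^^ i) (V ?e)) = moment \<beta> i" for i
  proof -
    have "cinner K ((N ^^ i) (V ?e)) ((N ^^ i) (V ?e)) = cinner ell2 ((?W ^^ i) ?e) ((?W ^^ i) ?e)"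
      unfolding orbit using V e[of i] by (auto simp: unitary_onto_def)
    also have "\<dots> = of_real ((\<Prod>j<i. \<beta> j)\<^sup>2)"
      unfolding ell2_simps weighted_shift_power l2_single(2) norm_of_real by simp
    finally have "quadratic ((N ^^ i) (V ?e)) = Re (of_real ((\<Prod>j<i. \<beta> j)\<^sup>2))"
      unfolding quadratic_def by (rule arg_cong)
    then show ?thesis by (simp only: Re_complex_of_real moment_def prod_power_distrib)
  qed
  have "moment \<beta> i \<le> 1" for i
    unfolding moment_def by (rule prod_le_1) (use le in \<open>auto simp: abs_square_le_1\<close>)
  then have "completely_monotone (\<lambda>i. quadratic ((N ^^ i) (V ?e)))"
    by (intro normal_orbit_completely_monotone[OF N V_mem, of 1]) (simp add: quad)
  then show ?thesis by (simp add: quad)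
qed

lemma contractive_shift_weights:
  assumes "contractive ell2 (weighted_shift \<alpha>)"
  shows "\<bar>\<alpha> n\<bar> \<le> 1"
proof -
  let ?W = "weighted_shift \<alpha>" and ?B = "{x \<in> carrier ell2. hnorm ell2 x \<le> 1}"
  have single: "hnorm ell2 (\<lambda>k. if k = i then of_real c else 0) = \<bar>c\<bar>" for i c
    by (simp add: hnorm_def l2_single)
  have e: "basis_vector n \<in> ?B"
    using l2_single(1)[of n 1] single[of n 1, unfolded of_real_1] by (simp add: basis_vector_def)
  have "?W (basis_vector n) = (\<lambda>k. if k = Suc n then of_real (\<alpha> n) else 0)"
    by (auto simp: weighted_shift_def basis_vector_def fun_eq_iff split: nat.split)
  then have We: "hnorm ell2 (?W (basis_vector n)) = \<bar>\<alpha> n\<bar>" by (simp only: single)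
  obtain C where C: "\<And>x. x \<in> carrier ell2 \<Longrightarrow> hnorm ell2 (?W x) \<le> C * hnorm ell2 x"
    using assms unfolding contractive_def bounded_operator_def by blast
  have "C \<ge> 0"
    using C[of "basis_vector n"] e We single[of n 1, unfolded of_real_1] by (simp add: basis_vector_def)
  have "bdd_above ((\<lambda>x. hnorm ell2 (?W x)) ` ?B)"
  proof (rule bdd_aboveI2)
    fix x assume "x \<in> ?B"
    then show "hnorm ell2 (?W x) \<le> C"
      using C[of x] mult_left_mono[of "hnorm ell2 x" 1 C] \<open>C \<ge> 0\<close> by simp
  qed
  then have "hnorm ell2 (?W (basis_vector n)) \<le> operator_norm ell2 ?W"
    unfolding operator_norm_def by (rule cSUP_upper[OF e])
  then show ?thesis using assms We by (simp add: contractive_def)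
qed

lemma moment_powr:
  assumes "\<And>n. \<alpha> n > 0"
  shows "moment (\<lambda>n. \<alpha> n powr p) = (\<lambda>n. exp (p * ln (moment \<alpha> n)))"
proof
  fix n
  have "ln (moment \<alpha> n) = (\<Sum>j<n. 2 * ln (\<alpha> j))"
    unfolding moment_def by (subst ln_prod) (use assms in \<open>auto simp: ln_realpow less_imp_neq[symmetric]\<close>)
  moreover have "(\<alpha> j powr p)\<^sup>2 = exp (p * (2 * ln (\<alpha> j)))" for j
    using assms[of j] by (simp add: powr_def power2_eq_square exp_add[symmetric])
  ultimately show "moment (\<lambda>n. \<alpha> n powr p) n = exp (p * ln (moment \<alpha> n))"
    by (simp add: moment_def[of "\<lambda>n. \<alpha> n powr p"] sum_distrib_left exp_sum)
qed

theorem theorem3p4: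
  fixes \<alpha> :: "nat \<Rightarrow> real"
  assumes "\<And>n. \<alpha> n > 0"
    and "bounded (range \<alpha>)"
    and "contractive ell2 (weighted_shift \<alpha>)"
  shows "moment_infinitely_divisible TYPE('k + (nat \<Rightarrow> complex)) \<alpha> \<longleftrightarrow>
         log_completely_monotone (moment \<alpha>)"
proof
  assume mid: "moment_infinitely_divisible TYPE('k + (nat \<Rightarrow> complex)) \<alpha>"
  have "completely_monotone (\<lambda>j. exp (p * ln (moment \<alpha> j)))" if "p > 0" for p
  proof -
    have "subnormal TYPE('k + (nat \<Rightarrow> complex)) ell2 (weighted_shift (\<lambda>n. \<alpha> n powr p))"
      using mid that by (simp add: moment_infinitely_divisible_def)
    moreover have "\<bar>\<alpha> n powr p\<bar> \<le> 1" for n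
      using contractive_shift_weights[OF assms(3), of n] assms(1)[of n] that
      by (simp add: powr_le1)
    ultimately have "completely_monotone (moment (\<lambda>n. \<alpha> n powr p))"
      by (rule subnormal_shift_completely_monotone)
    then show ?thesis by (simp only: moment_powr[OF assms(1)])
  qed
  then show "log_completely_monotone (moment \<alpha>)"
    unfolding log_completely_monotone_iff by (blast intro: log_completely_monotone_from_powers)
next
  assume log: "log_completely_monotone (moment \<alpha>)"
  show "moment_infinitely_divisible TYPE('k + (nat \<Rightarrow> complex)) \<alpha>"
    unfolding moment_infinitely_divisible_def
  proof (intro allI impI)
    fix p :: real assume "p \<ge> 0"
    then have "completely_monotone (\<lambda>j. exp (p * ln (moment \<alpha> j)))"
      using log by (intro completely_monotone_exp) (auto simp: log_completely_monotone_iff)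
    then show "subnormal TYPE('k + (nat \<Rightarrow> complex)) ell2 (weighted_shift (\<lambda>n. \<alpha> n powr p))"
            by (intro completely_monotone_shift_subnormal)
        (use assms(1) in \<open>simp_all add: moment_powr powr_gt_zero less_imp_neq[symmetric]\<close>)
  qed
qed

end
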